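(* Let $X$ be a Banach space which is not super-reflexive. Then, for each $\varepsilon>0$ and each integer $n\ge 1$, there exists a mapping $f_n\colon \mathcal{L}_n\to X$ such that, for all $a,b\in\mathcal{L}_n$, $$\frac12 d(a,b)-\varepsilon\le \|f_n(a)-f_n(b)\|\le d(a,b),$$ where $\mathcal{L}_n$ denotes (the vertex set of) the Laakso graph of level $n$ and $d$ is its shortest-path metric.
   Context: A Banach space $X$ is super-reflexive if every Banach space $Y$ which is finitely representable in $X$ is reflexive. ($Y$ is finitely representable in $X$ if for every finite-dimensional subspace $F\subseteq Y$ and every $\delta>0$ there is a linear isomorphism $S$ from $F$ onto a subspace of $X$ with $\|S\|\,\|S^{-1}\|\le 1+\delta$.) Laakso graphs: $\mathcal{L}_0$ has two vertices joined by an edge. $\mathcal{L}_1$ is the graph with six vertices $A,T,L,R,B,U$ and six edges $AT$, $TL$, $TR$, $LB$, $RB$, $BU$. For $n\ge1$, $\mathcal{L}_n$ is obtained from $\mathcal{L}_{n-1}$ by replacing each edge $uv$ of $\mathcal{L}_{n-1}$ by a copy of $\mathcal{L}_1$, with $u$ and $v$ identified with the vertices $A$ and $U$ of the copy (the other four vertices of each copy being new; which endpoint plays the role of $A$ does not matter, up to isomorphism, by symmetry). Every edge of $\mathcal{L}_n$ has length $1$, and $\mathcal{L}_n$ is regarded as a metric space on its vertex set with the shortest-path metric $d$. *)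

theory Defs
  imports "HOL-Analysis.Analysis"
begin

definition bidual_embedding :: "'a::real_normed_vector \<Rightarrow> ('a \<Rightarrow>\<^sub>L real) \<Rightarrow>\<^sub>L real" where
  "bidual_embedding x = Blinfun (\<lambda>\<phi>. blinfun_apply \<phi> x)"

lemma bidual_embedding_apply [simp]:
  "blinfun_apply (bidual_embedding x) \<phi> = blinfun_apply \<phi> x"
  by (simp add: bidual_embedding_def bounded_linear_Blinfun_apply blinfun.bounded_linear_left)

definition reflexive_space :: "'a::banach itself \<Rightarrow> bool" where
  "reflexive_space _ \<longleftrightarrow>
     surj (bidual_embedding :: 'a \<Rightarrow> ('a \<Rightarrow>\<^sub>L real) \<Rightarrow>\<^sub>L real)"

definition linear_on_subspace ::
  "'a::real_vector set \<Rightarrow> ('a \<Rightarrow> 'b::real_vector) \<Rightarrow> bool" where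
  "linear_on_subspace F S \<longleftrightarrow>
     (\<forall>x\<in>F. \<forall>y\<in>F. S (x + y) = S x + S y) \<and> (\<forall>c. \<forall>x\<in>F. S (c *\<^sub>R x) = c *\<^sub>R S x)"

text \<open>
  Relative version of \<^const>\<open>onorm\<close>. It is only used for linear maps on finite-dimensional
  subspaces, where the set of quotients is bounded and the supremum is therefore meaningful;
  as for \<^const>\<open>onorm\<close>, the quotient at the zero vector is zero.
\<close>

definition onorm_on ::
  "'a::real_normed_vector set \<Rightarrow> ('a \<Rightarrow> 'b::real_normed_vector) \<Rightarrow> real" where
  "onorm_on F S = (SUP x\<in>F. norm (S x) / norm x)"

text \<open>\<open>finitely_representable TYPE('y) TYPE('x)\<close>: the space \<open>'y\<close> is finitely representable
  in the space \<open>'x\<close>.\<close>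

definition finitely_representable ::
  "'y::banach itself \<Rightarrow> 'x::banach itself \<Rightarrow> bool" where
  "finitely_representable _ _ \<longleftrightarrow>
     (\<forall>F :: 'y set. \<forall>\<delta>>0. subspace F \<and> (\<exists>B. finite B \<and> F = span B) \<longrightarrow>
        (\<exists>S :: 'y \<Rightarrow> 'x. linear_on_subspace F S \<and> inj_on S F \<and>
           onorm_on F S * onorm_on (S ` F) (inv_into F S) \<le> 1 + \<delta>))"

text \<open>
  Super-reflexivity of \<open>'x\<close> quantifies over all Banach spaces \<open>'y\<close>, hence over types, and cannot
  be a predicate of HOL. The hypothesis that \<open>'x\<close> is not super-reflexive asserts the existence of
  a non-reflexive Banach space finitely representable in \<open>'x\<close>; as a premise, this existential is
  a type variable \<open>'y :: banach\<close>, arbitrary at the level of the theorem, subject to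
  \<open>finitely_representable TYPE('y) TYPE('x)\<close> and \<open>\<not> reflexive_space TYPE('y)\<close>.
\<close>

text \<open>
  Laakso graphs. \<open>Inner u v p\<close> is the new vertex at position \<open>p\<close> in the copy that replaces the
  edge \<open>uv\<close>. The level need not be recorded, because an edge \<open>uv\<close> belongs to a single level
  (see \<open>laakso_edge_depth\<close> below).
  Edges are oriented from the \<open>A\<close>-end to the \<open>U\<close>-end; the orientation only fixes which endpoint
  plays the role of \<open>A\<close> and is forgotten in the metric.
\<close>

datatype laakso_position = T | L | R | B

datatype laakso_vertex =
    Source
  | Sink
  | Inner laakso_vertex laakso_vertex laakso_position

definition laakso_copy ::
  "laakso_vertex \<Rightarrow> laakso_vertex \<Rightarrow> (laakso_vertex \<times> laakso_vertex) set" where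
  "laakso_copy u v =
     {(u, Inner u v T),
      (Inner u v T, Inner u v L), (Inner u v T, Inner u v R),
      (Inner u v L, Inner u v B), (Inner u v R, Inner u v B),
      (Inner u v B, v)}"

primrec laakso_edges :: "nat \<Rightarrow> (laakso_vertex \<times> laakso_vertex) set" where
  "laakso_edges 0 = {(Source, Sink)}"
| "laakso_edges (Suc n) = (\<Union>(u, v)\<in>laakso_edges n. laakso_copy u v)"

definition laakso_vertices :: "nat \<Rightarrow> laakso_vertex set" where
  "laakso_vertices n = Field (laakso_edges n)"

text \<open>The least length of a walk from \<open>a\<close> to \<open>b\<close> in the underlying undirected graph. The default
  value of \<open>LEAST\<close> plays no role on \<open>laakso_vertices n\<close>, by \<open>laakso_connected\<close> below.\<close>

definition laakso_dist :: "nat \<Rightarrow> laakso_vertex \<Rightarrow> laakso_vertex \<Rightarrow> nat" where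
  "laakso_dist n a b =
     (LEAST k. (a, b) \<in> (laakso_edges n \<union> (laakso_edges n)\<inverse>) ^^ k)"

primrec laakso_depth :: "laakso_vertex \<Rightarrow> nat" where
  "laakso_depth Source = 0"
| "laakso_depth Sink = 0"
| "laakso_depth (Inner u v p) = Suc (max (laakso_depth u) (laakso_depth v))"

lemma laakso_edge_depth:
  "(u, v) \<in> laakso_edges n \<Longrightarrow> max (laakso_depth u) (laakso_depth v) = n"
proof (induction n arbitrary: u v)
  case 0
  then show ?case by simp
next
  case (Suc n)
  then obtain x y where xy: "(x, y) \<in> laakso_edges n" "(u, v) \<in> laakso_copy x y"
    by auto
  from Suc.IH[OF xy(1)] xy(2) show ?case
    by (auto simp: laakso_copy_def)
qed

lemma laakso_inner_new:
  assumes "(u, v) \<in> laakso_edges n"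
  shows "Inner u v p \<notin> laakso_vertices n"
proof
  assume "Inner u v p \<in> laakso_vertices n"
  then obtain w where
    "(Inner u v p, w) \<in> laakso_edges n \<or> (w, Inner u v p) \<in> laakso_edges n"
    by (auto simp: laakso_vertices_def Field_def)
  then show False
    using laakso_edge_depth[OF assms]
      laakso_edge_depth[of "Inner u v p" w n] laakso_edge_depth[of w "Inner u v p" n]
    by auto
qed

lemma laakso_connected:
  assumes "a \<in> laakso_vertices n" and "b \<in> laakso_vertices n"
  shows "(a, b) \<in> (laakso_edges n \<union> (laakso_edges n)\<inverse>)\<^sup>*"
proof -
  define G where "G m = (laakso_edges m \<union> (laakso_edges m)\<inverse>)\<^sup>*" for m
  have symG: "sym (G m)" for m
    unfolding G_def by (intro sym_rtrancl) (auto simp: sym_def)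
  have transG: "trans (G m)" for m
    unfolding G_def by (rule trans_rtrancl)
  have "\<forall>x\<in>laakso_vertices n. (Source, x) \<in> G n"
  proof (induction n)
    case 0
    then show ?case by (auto simp: G_def laakso_vertices_def Field_def)
  next
    case (Suc n)
    have cp: "(u, w) \<in> G (Suc n)"
      if e: "(u, v) \<in> laakso_edges n" and w: "w \<in> Field (laakso_copy u v)" for u v w
    proof -
      have sub: "laakso_copy u v \<subseteq> G (Suc n)"
        using e unfolding G_def by force
      have e1: "(u, Inner u v T) \<in> G (Suc n)" and
        e2: "(Inner u v T, Inner u v L) \<in> G (Suc n)" and
        e3: "(Inner u v T, Inner u v R) \<in> G (Suc n)" and
        e4: "(Inner u v L, Inner u v B) \<in> G (Suc n)" and
        e5: "(Inner u v B, v) \<in> G (Suc n)"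
        using sub by (auto simp: laakso_copy_def)
      have "(u, u) \<in> G (Suc n)" by (simp add: G_def)
      moreover note e1
      moreover have l: "(u, Inner u v L) \<in> G (Suc n)" using transD[OF transG e1 e2] .
      moreover have "(u, Inner u v R) \<in> G (Suc n)" using transD[OF transG e1 e3] .
      moreover have b: "(u, Inner u v B) \<in> G (Suc n)" using transD[OF transG l e4] .
      moreover have "(u, v) \<in> G (Suc n)" using transD[OF transG b e5] .
      ultimately show ?thesis
        using w by (auto simp: laakso_copy_def Field_def)
    qed
    have "laakso_edges n \<subseteq> G (Suc n)"
      using cp by (force simp: laakso_copy_def Field_def)
    then have "laakso_edges n \<union> (laakso_edges n)\<inverse> \<subseteq> G (Suc n)"
      using symG[of "Suc n"] by (auto simp: sym_def)
    then have "G n \<subseteq> (G (Suc n))\<^sup>*"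
      unfolding G_def[of n] by (rule rtrancl_mono)
    then have mono: "G n \<subseteq> G (Suc n)"
      by (simp add: G_def[of "Suc n"])
    show ?case
    proof
      fix x assume "x \<in> laakso_vertices (Suc n)"
      then obtain u v where e: "(u, v) \<in> laakso_edges n" and x: "x \<in> Field (laakso_copy u v)"
        by (fastforce simp: laakso_vertices_def Field_def)
      have "(Source, u) \<in> G n"
        using Suc.IH e by (auto simp: laakso_vertices_def Field_def)
      with mono have "(Source, u) \<in> G (Suc n)" by blast
      from transD[OF transG this cp[OF e x]] show "(Source, x) \<in> G (Suc n)" .
    qed
  qed
  with assms have "(Source, a) \<in> G n" "(Source, b) \<in> G n" by auto
  then have "(a, b) \<in> G n"
    using symG[of n] transG[of n] by (meson symD transD)
  then show ?thesis by (simp add: G_def)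
qed

hide_const (open) T L R B

end

(*
  If the space Y is not reflexive, pick Phi in the bidual of Y at positive distance from Y. The
  Hahn-Banach theorem and Helly's interpolation theorem, used alternately in Y and in its dual,
  give bounded sequences x, g with g_i(x_j) = 1 for i <= j and 0 otherwise. For an increasing
  sequence p, consider the vectors on which g_i takes the values 1, -1, 1, ... on the successive
  intervals (p_0, p_1], (p_2, p_3], ..., n of them. By Ramsey's theorem their least norm is
  almost independent of p, say K_n. As K_n grows at most linearly, K_n / K_(n+1) is almost 1 for
  some n. Take m almost minimal vectors for n+1 intervals, staggered so that every signed average
  (z_1 + ... + z_k - z_(k+1) - ... - z_m) / m is alternating on n intervals. After normalization
  the z_j are vectors of the unit ball all of whose signed sums of this form have norm almost m;
  finite representability transports them to X.

  With m = 4^n, each vertex a of the Laakso graph gets a set of indices A(a) that grows by one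
  element along each oriented edge, and a is mapped to the sum of x_j over A(a). This map is
  1-Lipschitz, and ||f a - f b|| is almost at least the difference between A(a) and A(b) of the
  number of elements below k minus the number of elements from k on, for each k. The two edges
  TL and RB use the second quarter of the indices, TR and LB the third one, which makes one of
  these differences at least d(a,b)/2.
*)
theory Submission
  imports Defs "HOL-Library.Ramsey"
begin

section \<open>The Hahn-Banach theorem\<close>

definition sublinear :: "('a::real_vector \<Rightarrow> real) \<Rightarrow> bool" where
  "sublinear p \<longleftrightarrow>
     (\<forall>x y. p (x + y) \<le> p x + p y) \<and> (\<forall>c\<ge>0. \<forall>x. p (c *\<^sub>R x) = c * p x)"

lemma sublinear_add: "sublinear p \<Longrightarrow> p (x + y) \<le> p x + p y"
  by (simp add: sublinear_def)

lemma sublinear_scale: "sublinear p \<Longrightarrow> c \<ge> 0 \<Longrightarrow> p (c *\<^sub>R x) = c * p x"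
  by (simp add: sublinear_def)

lemma sublinear_zero: "sublinear p \<Longrightarrow> p 0 = 0"
  using sublinear_scale[of p 0 0] by simp

lemma sublinear_lower: "sublinear p \<Longrightarrow> - p (- x) \<le> p x"
  using sublinear_add[of p x "- x"] sublinear_zero[of p] by simp

text \<open>The one-sided bound for \<open>inverse c\<close> at the point
  \<open>c *\<^sub>R x\<close> is the reverse inequality for \<open>c\<close>.\<close>

lemma sublinearI:
  assumes "\<And>x y. p (x + y) \<le> p x + p y"
    and "\<And>c x. c > 0 \<Longrightarrow> p (c *\<^sub>R x) \<le> c * p x" and "p 0 = 0"
  shows "sublinear p"
proof -
  have "p (c *\<^sub>R x) = c * p x" if "c \<ge> 0" for c x
  proof (cases "c = 0")
    case False
    with that have c: "c > 0" by simp
    have "p (inverse c *\<^sub>R c *\<^sub>R x) \<le> inverse c * p (c *\<^sub>R x)"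
      using c by (intro assms(2)) simp
    with c have "c * p x \<le> p (c *\<^sub>R x)"
      by (simp add: field_simps)
    with assms(2)[OF c] show ?thesis by (intro antisym)
  qed (simp add: assms(3))
  with assms(1) show ?thesis by (simp add: sublinear_def)
qed

text \<open>For sublinear \<open>q\<close> this is again sublinear, lies below \<open>q\<close> and
  takes the value \<open>- q v\<close> at \<open>- v\<close>: it is a minorant of \<open>q\<close>
  that is linear along the line through \<open>v\<close>.\<close>

definition directional :: "('a::real_vector \<Rightarrow> real) \<Rightarrow> 'a \<Rightarrow> 'a \<Rightarrow> real" where
  "directional q v x = (INF t\<in>{0..}. q (x + t *\<^sub>R v) - t * q v)"

lemma directional_bdd:
  assumes "sublinear q"
  shows "bdd_below ((\<lambda>t. q (x + t *\<^sub>R v) - t * q v) ` {0..})"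
proof (rule bdd_belowI2)
  fix t :: real assume "t \<in> {0..}"
  then have "q (t *\<^sub>R v) = t * q v" using assms by (simp add: sublinear_scale)
  moreover have "q (t *\<^sub>R v) \<le> q (x + t *\<^sub>R v) + q (- x)"
    using sublinear_add[OF assms, of "x + t *\<^sub>R v" "- x"] by simp
  ultimately show "- q (- x) \<le> q (x + t *\<^sub>R v) - t * q v" by simp
qed

lemma directional_le:
  assumes "sublinear q" "t \<ge> 0"
  shows "directional q v x \<le> q (x + t *\<^sub>R v) - t * q v"
  unfolding directional_def by (rule cINF_lower[OF directional_bdd]) (use assms in auto)

lemma sublinear_directional:
  assumes q: "sublinear q"
  shows "sublinear (directional q v)"
proof (rule sublinearI)
  fix x y
  \<comment> \<open>Parameters \<open>s\<close> for \<open>x\<close> and \<open>t\<close> for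
    \<open>y\<close> combine to \<open>s + t\<close> for \<open>x + y\<close>; the infimum is then
    taken over \<open>s\<close> first and over \<open>t\<close> afterwards.\<close>
  have 1: "directional q v (x + y) - (q (y + t *\<^sub>R v) - t * q v) \<le> q (x + s *\<^sub>R v) - s * q v"
    if "s \<ge> 0" "t \<ge> 0" for s t
    using directional_le[OF q, of "s + t" v "x + y"] that
      sublinear_add[OF q, of "x + s *\<^sub>R v" "y + t *\<^sub>R v"]
    by (simp add: algebra_simps)
  have "directional q v (x + y) - (q (y + t *\<^sub>R v) - t * q v) \<le> directional q v x"
    if "t \<ge> 0" for t
    unfolding directional_def[of q v x] by (rule cINF_greatest) (use 1 that in auto)
  then have "directional q v (x + y) - directional q v x \<le> q (y + t *\<^sub>R v) - t * q v"
    if "t \<ge> 0" for t using that by (auto simp: algebra_simps)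
  then have "directional q v (x + y) - directional q v x \<le> directional q v y"
    unfolding directional_def[of q v y] by (intro cINF_greatest) auto
  then show "directional q v (x + y) \<le> directional q v x + directional q v y" by simp
next
  fix c :: real and x assume c: "c > 0"
  have "directional q v (c *\<^sub>R x) / c \<le> q (x + t *\<^sub>R v) - t * q v" if "t \<ge> 0" for t
  proof -
    have "directional q v (c *\<^sub>R x) \<le> q (c *\<^sub>R (x + t *\<^sub>R v)) - c * t * q v"
      using directional_le[OF q, of "c * t" v "c *\<^sub>R x"] c that by (simp add: algebra_simps)
    also have "q (c *\<^sub>R (x + t *\<^sub>R v)) = c * q (x + t *\<^sub>R v)"
      using c q by (simp only: sublinear_scale less_imp_le)
    finally show ?thesis using c by (simp add: field_simps)
  qed
  then have "directional q v (c *\<^sub>R x) / c \<le> directional q v x"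
    unfolding directional_def[of q v x] by (intro cINF_greatest) auto
  with c show "directional q v (c *\<^sub>R x) \<le> c * directional q v x"
    by (simp add: field_simps)
next
  show "directional q v 0 = 0"
    using q by (simp add: directional_def sublinear_scale)
qed

text \<open>Zorn's lemma for the reversed pointwise order. The pointwise infimum of a chain is
  finite, because every sublinear minorant of \<open>p\<close> is at least \<open>- p (- x)\<close>
  at \<open>x\<close>.\<close>

lemma minimal_sublinear:
  fixes p :: "'a::real_vector \<Rightarrow> real"
  assumes p: "sublinear p"
  shows "\<exists>q. sublinear q \<and> q \<le> p \<and> (\<forall>r. sublinear r \<longrightarrow> r \<le> q \<longrightarrow> r = q)"
proof -
  define A where "A = {q. sublinear q \<and> q \<le> p}"
  have "\<exists>m\<in>A. \<forall>a\<in>A. m \<ge> a \<longrightarrow> a = m"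
  proof (rule predicate_Zorn)
    show "partial_order_on A (relation_of (\<ge>) A)"
      by (rule partial_order_on_relation_ofI) auto
  next
    fix C assume C: "C \<in> Chains (relation_of (\<ge>) A)"
    have CA: "C \<subseteq> A" using C by (rule Chains_relation_of)
    have ch: "a \<le> b \<or> b \<le> a" if "a \<in> C" "b \<in> C" for a b
      using C that by (auto simp: Chains_def relation_of_def)
    show "\<exists>u\<in>A. \<forall>a\<in>C. a \<ge> u"
    proof (cases "C = {}")
      case True
      with p show ?thesis by (auto simp: A_def)
    next
      case False
      define u where "u x = (INF a\<in>C. a x)" for x
      have bdd: "bdd_below ((\<lambda>a. a x) ` C)" for x
      proof (rule bdd_belowI2)
        fix a assume "a \<in> C"
        with CA have a: "sublinear a" "a \<le> p" by (auto simp: A_def)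
        show "- p (- x) \<le> a x"
          using sublinear_lower[OF a(1), of x] le_funD[OF a(2), of "- x"] by linarith
      qed
      have ule: "u x \<le> a x" if "a \<in> C" for a x
        unfolding u_def by (rule cINF_lower[OF bdd that])
      have uge: "b \<le> u x" if "\<And>a. a \<in> C \<Longrightarrow> b \<le> a x" for b x
        unfolding u_def by (rule cINF_greatest[OF False that])
      have "sublinear u"
      proof (rule sublinearI)
        fix x y
        \<comment> \<open>A pointwise infimum of sublinear functions need not be subadditive. In a
          chain, \<open>a\<close> and \<open>b\<close> have a common lower member \<open>c\<close>,
          whose subadditivity can be used.\<close>
        have "u (x + y) \<le> b y + a x" if ab: "a \<in> C" "b \<in> C" for a b
        proof -
          obtain c where c: "c \<in> C" "c \<le> a" "c \<le> b" using ch[OF ab] ab by auto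
          have "u (x + y) \<le> c x + c y"
            using ule[OF c(1), of "x + y"] sublinear_add[of c x y] c(1) CA by (force simp: A_def)
          also have "\<dots> \<le> b y + a x" using le_funD[OF c(2), of x] le_funD[OF c(3), of y] by simp
          finally show ?thesis .
        qed
        then have "u (x + y) - a x \<le> u y" if "a \<in> C" for a
          using that by (intro uge) (simp add: diff_le_eq)
        then have "u (x + y) - u y \<le> u x" by (intro uge) (simp add: diff_le_eq add.commute)
        then show "u (x + y) \<le> u x + u y" by simp
      next
        fix c :: real and x assume c: "c > 0"
        have "u (c *\<^sub>R x) / c \<le> u x"
        proof (rule uge)
          fix a assume a: "a \<in> C"
          with CA have "a (c *\<^sub>R x) = c * a x" using c by (auto simp: A_def sublinear_scale)
          with ule[OF a, of "c *\<^sub>R x"] c show "u (c *\<^sub>R x) / c \<le> a x" by (simp add: field_simps)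
        qed
        with c show "u (c *\<^sub>R x) \<le> c * u x" by (simp add: field_simps)
      next
        have "(\<lambda>a. a 0) ` C = (\<lambda>_. 0) ` C"
          using CA by (intro image_cong) (auto simp: A_def sublinear_zero)
        then show "u 0 = 0" using False by (simp add: u_def)
      qed
      moreover have "u \<le> p"
      proof -
        obtain a where "a \<in> C" using False by auto
        with CA ule show ?thesis by (force simp: A_def le_fun_def intro: order_trans)
      qed
      ultimately show ?thesis using ule by (auto simp: A_def le_fun_def)
    qed
  qed
  then obtain m where m: "m \<in> A" "\<And>a. a \<in> A \<Longrightarrow> a \<le> m \<Longrightarrow> a = m" by auto
  have "r = m" if "sublinear r" "r \<le> m" for r
    using m that by (auto simp: A_def)
  with m(1) show ?thesis by (auto simp: A_def)
qed

text \<open>By minimality, \<open>q\<close> equals \<open>directional q v\<close> for every \<open>v\<close>, which forces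
  \<open>q (- v) = - q v\<close>.\<close>

lemma minimal_sublinear_linear:
  fixes q :: "'a::real_vector \<Rightarrow> real"
  assumes q: "sublinear q" and min: "\<And>r. sublinear r \<Longrightarrow> r \<le> q \<Longrightarrow> r = q"
  shows "linear q"
proof -
  have neg: "q (- v) = - q v" for v
  proof -
    have "directional q v \<le> q"
      using directional_le[OF q, of 0 v] by (simp add: le_fun_def)
    then have "directional q v = q" by (rule min[OF sublinear_directional[OF q]])
    with directional_le[OF q, of 1 v "- v"] have "q (- v) \<le> - q v"
      by (simp add: sublinear_zero[OF q])
    with sublinear_lower[OF q, of v] show ?thesis by simp
  qed
  show ?thesis
  proof (rule linearI)
    fix x y
    show "q (x + y) = q x + q y"
      using sublinear_add[OF q, of x y] sublinear_add[OF q, of "- x" "- y"]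
        neg[of x] neg[of y] neg[of "x + y"] by simp
  next
    fix c x
    show "q (c *\<^sub>R x) = c *\<^sub>R q x"
    proof (cases "c \<ge> 0")
      case False
      then have "q ((- c) *\<^sub>R x) = (- c) * q x" by (intro sublinear_scale[OF q]) simp
      with neg[of "c *\<^sub>R x"] show ?thesis by simp
    qed (simp add: sublinear_scale[OF q])
  qed
qed

text \<open>The minimal functional is taken below \<open>directional p v\<close> instead of
  \<open>p\<close>: this bounds its value at \<open>- v\<close> by \<open>- p v\<close>, which by
  linearity forces equality at \<open>v\<close>.\<close>

lemma hahn_banach_sublinear:
  fixes p :: "'a::real_vector \<Rightarrow> real"
  assumes p: "sublinear p"
  obtains f where "linear f" "\<And>x. f x \<le> p x" "f v = p v"
proof -
  obtain q where q: "sublinear q" "q \<le> directional p v"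
    "\<And>r. sublinear r \<Longrightarrow> r \<le> q \<Longrightarrow> r = q"
    using minimal_sublinear[OF sublinear_directional[OF p]] by blast
  have lin: "linear q" using minimal_sublinear_linear[OF q(1,3)] .
  have le: "q x \<le> p x" for x
    using le_funD[OF q(2), of x] directional_le[OF p, of 0 v x] by simp
  have "q (- v) \<le> - p v"
    using le_funD[OF q(2), of "- v"] directional_le[OF p, of 1 v "- v"]
    by (simp add: sublinear_zero[OF p])
  then have "q v = p v" using le[of v] linear_neg[OF lin, of v] by simp
  with lin le that show thesis by blast
qed

section \<open>Functionals attached to the distance from a subspace\<close>

lemma infdist_add_subspace:
  fixes W :: "'a::real_normed_vector set"
  assumes W: "subspace W"
  shows "infdist (x + y) W \<le> infdist x W + infdist y W"
proof -
  have ne: "W \<noteq> {}" using subspace_0[OF W] by auto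
  have "infdist (x + y) W \<le> dist x a + dist y b" if "a \<in> W" "b \<in> W" for a b
  proof -
    have "infdist (x + y) W \<le> dist (x + y) (a + b)"
      using that by (intro infdist_le subspace_add[OF W])
    also have "\<dots> \<le> dist x a + dist y b" by (rule dist_triangle_add)
    finally show ?thesis .
  qed
  then have "infdist (x + y) W - dist x a \<le> infdist y W" if "a \<in> W" for a
    unfolding infdist_notempty[OF ne, of y] using that
    by (intro cINF_greatest[OF ne]) (auto simp: algebra_simps)
  then have "infdist (x + y) W - infdist y W \<le> infdist x W"
    unfolding infdist_notempty[OF ne, of x]
    by (intro cINF_greatest[OF ne]) (auto simp: algebra_simps)
  then show ?thesis by simp
qed

lemma sublinear_infdist:
  fixes W :: "'a::real_normed_vector set"
  assumes W: "subspace W"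
  shows "sublinear (\<lambda>x. infdist x W)"
proof (rule sublinearI)
  show "infdist (x + y) W \<le> infdist x W + infdist y W" for x y
    by (rule infdist_add_subspace[OF W])
next
  have ne: "W \<noteq> {}" using subspace_0[OF W] by auto
  fix c :: real and x :: 'a assume c: "c > 0"
  have "infdist (c *\<^sub>R x) W / c \<le> infdist x W"
    unfolding infdist_notempty[OF ne, of x]
  proof (rule cINF_greatest[OF ne])
    fix a assume "a \<in> W"
    then have "infdist (c *\<^sub>R x) W \<le> dist (c *\<^sub>R x) (c *\<^sub>R a)"
      by (intro infdist_le subspace_scale[OF W])
    also have "\<dots> = c * dist x a" using c
      by (simp add: dist_norm flip: scaleR_diff_right)
    finally show "infdist (c *\<^sub>R x) W / c \<le> dist x a"
      using c by (simp add: field_simps)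
  qed
  with c show "infdist (c *\<^sub>R x) W \<le> c * infdist x W" by (simp add: field_simps)
next
  show "infdist 0 W = 0" using subspace_0[OF W] by simp
qed

text \<open>The distance to \<open>W\<close> is sublinear, at most the norm, and zero on
  \<open>W\<close>, so a linear functional below it has norm at most one and vanishes on
  \<open>W\<close>. For \<open>W = {0}\<close> this is a norming functional of
  \<open>v\<close>.\<close>

lemma hahn_banach_infdist:
  fixes W :: "'a::real_normed_vector set"
  assumes W: "subspace W"
  obtains \<phi> :: "'a \<Rightarrow>\<^sub>L real"
  where "\<And>w. w \<in> W \<Longrightarrow> blinfun_apply \<phi> w = 0" "norm \<phi> \<le> 1" "blinfun_apply \<phi> v = infdist v W"
proof -
  obtain f where f: "linear f" "\<And>x. f x \<le> infdist x W" "f v = infdist v W"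
    using hahn_banach_sublinear[OF sublinear_infdist[OF W]] by blast
  have le: "infdist x W \<le> norm x" for x
    using infdist_le[OF subspace_0[OF W], of x] by simp
  have bd: "\<bar>f x\<bar> \<le> norm x" for x
    using f(2)[of x] f(2)[of "- x"] le[of x] le[of "- x"] linear_neg[OF f(1), of x] by simp
  have bl: "bounded_linear f"
    by (rule bounded_linear_intro[where K = 1])
      (use f(1) bd in \<open>auto simp: linear_add linear_scale\<close>)
  have ap: "blinfun_apply (Blinfun f) = f" by (rule bounded_linear_Blinfun_apply[OF bl])
  have "norm (Blinfun f) \<le> 1" by (rule norm_blinfun_bound) (use bd ap in auto)
  moreover have "f w = 0" if "w \<in> W" for w
    using f(2)[of w] f(2)[of "- w"] linear_neg[OF f(1), of w] subspace_neg[OF W that] that by simp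
  ultimately show thesis using that[of "Blinfun f"] f(3) ap by simp
qed

section \<open>Biorthogonal triangles in non-reflexive spaces\<close>

lemma subspace_common_kernel:
  "subspace {z. \<forall>f\<in>G. blinfun_apply f z = 0}"
  by (auto simp: subspace_def blinfun.add_right blinfun.scaleR_right)

text \<open>By induction on \<open>G\<close>. A vector \<open>w\<close> in the kernel of
  \<open>G\<close> with \<open>f w\<close> nonzero moves every \<open>z\<close> of that kernel into
  the kernel of \<open>f\<close>, so a suitable \<open>\<phi> - c *\<^sub>R f\<close> vanishes on
  the kernel of \<open>G\<close>. Without such a \<open>w\<close>, the functional \<open>f\<close>
  does not shrink the kernel.\<close>

lemma vanishing_on_common_kernel_in_span:
  fixes G :: "('a::real_normed_vector \<Rightarrow>\<^sub>L real) set"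
  assumes "finite G"
    and "\<And>z. (\<forall>f\<in>G. blinfun_apply f z = 0) \<Longrightarrow> blinfun_apply \<phi> z = 0"
  shows "\<phi> \<in> span G"
  using assms
proof (induction G arbitrary: \<phi> rule: finite_induct)
  case empty
  then have "\<phi> = 0" by (intro blinfun_eqI) simp
  then show ?case by simp
next
  case (insert f G)
  show ?case
  proof (cases "\<exists>w. (\<forall>h\<in>G. blinfun_apply h w = 0) \<and> blinfun_apply f w \<noteq> 0")
    case True
    then obtain w where w: "\<forall>h\<in>G. blinfun_apply h w = 0" "blinfun_apply f w \<noteq> 0" by blast
    define c where "c = blinfun_apply \<phi> w / blinfun_apply f w"
    have "\<phi> - c *\<^sub>R f \<in> span G"
    proof (rule insert.IH)
      fix z assume z: "\<forall>h\<in>G. blinfun_apply h z = 0"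
      define a where "a = blinfun_apply f z / blinfun_apply f w"
      have "blinfun_apply \<phi> (z - a *\<^sub>R w) = 0"
        using w z by (intro insert.prems) (auto simp: a_def blinfun.diff_right blinfun.scaleR_right)
      then show "blinfun_apply (\<phi> - c *\<^sub>R f) z = 0"
        by (simp add: a_def c_def blinfun.diff_right blinfun.diff_left blinfun.scaleR_left
            blinfun.scaleR_right mult.commute)
    qed
    then show ?thesis unfolding span_insert by blast
  next
    case False
    then have "\<phi> \<in> span G" by (intro insert.IH insert.prems) auto
    then show ?thesis using span_mono[of G "insert f G"] by blast
  qed
qed

lemma blinfun_eq_on_span:
  assumes "\<And>x. x \<in> B \<Longrightarrow> blinfun_apply F x = blinfun_apply H x" "x \<in> span B"
  shows "blinfun_apply F x = blinfun_apply H x"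
  using assms(2)
  by (induction rule: span_induct_alt) (simp_all add: assms(1) blinfun.add_right blinfun.scaleR_right)

text \<open>Interpolation without control of the norm. Either the value at the new \<open>f\<close>
  is corrected along a \<open>w\<close> in the kernel of \<open>G\<close>, or \<open>f\<close> lies
  in the span of \<open>G\<close> and its value is right by linearity.\<close>

lemma exists_interpolating_vector:
  fixes G :: "('a::real_normed_vector \<Rightarrow>\<^sub>L real) set" and \<Phi> :: "('a \<Rightarrow>\<^sub>L real) \<Rightarrow>\<^sub>L real"
  assumes "finite G"
  shows "\<exists>z. \<forall>f\<in>span G. blinfun_apply f z = blinfun_apply \<Phi> f"
proof -
  have "\<exists>z. \<forall>f\<in>G. blinfun_apply f z = blinfun_apply \<Phi> f"
    using assms
  proof (induction G rule: finite_induct)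
    case (insert f G)
    then obtain z where z: "\<forall>h\<in>G. blinfun_apply h z = blinfun_apply \<Phi> h" by blast
    show ?case
    proof (cases "\<exists>w. (\<forall>h\<in>G. blinfun_apply h w = 0) \<and> blinfun_apply f w \<noteq> 0")
      case True
      then obtain w where w: "\<forall>h\<in>G. blinfun_apply h w = 0" "blinfun_apply f w \<noteq> 0" by blast
      define c where "c = (blinfun_apply \<Phi> f - blinfun_apply f z) / blinfun_apply f w"
      have "\<forall>h\<in>insert f G. blinfun_apply h (z + c *\<^sub>R w) = blinfun_apply \<Phi> h"
        using w z by (auto simp: c_def blinfun.add_right blinfun.scaleR_right)
      then show ?thesis by blast
    next
      case False
      then have "f \<in> span G"
        using insert.hyps by (intro vanishing_on_common_kernel_in_span) auto
      then have "blinfun_apply (bidual_embedding z) f = blinfun_apply \<Phi> f"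
        by (intro blinfun_eq_on_span[OF _ \<open>f \<in> span G\<close>]) (use z in simp)
      with z show ?thesis by auto
    qed
  qed auto
  then obtain z where z: "\<forall>f\<in>G. blinfun_apply f z = blinfun_apply \<Phi> f" by blast
  have "blinfun_apply (bidual_embedding z) f = blinfun_apply \<Phi> f" if "f \<in> span G" for f
    by (rule blinfun_eq_on_span[OF _ that]) (use z in simp)
  then show ?thesis by auto
qed

text \<open>A functional vanishing on the common kernel \<open>W\<close> of \<open>G\<close> lies in the span of \<open>G\<close>, so a norming
  functional for the distance of an interpolating vector to \<open>W\<close> is controlled by \<open>\<Phi>\<close>.\<close>

lemma helly_interpolation:
  fixes G :: "('a::real_normed_vector \<Rightarrow>\<^sub>L real) set" and \<Phi> :: "('a \<Rightarrow>\<^sub>L real) \<Rightarrow>\<^sub>L real"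
  assumes G: "finite G" and M: "norm \<Phi> < M"
  obtains z where "\<And>f. f \<in> G \<Longrightarrow> blinfun_apply f z = blinfun_apply \<Phi> f" "norm z < M"
proof -
  obtain z where z: "\<And>f. f \<in> span G \<Longrightarrow> blinfun_apply f z = blinfun_apply \<Phi> f"
    using exists_interpolating_vector[OF G, of \<Phi>] by blast
  define W where "W = {z. \<forall>f\<in>G. blinfun_apply f z = 0}"
  have W: "subspace W" unfolding W_def by (rule subspace_common_kernel)
  obtain \<phi> :: "'a \<Rightarrow>\<^sub>L real" where \<phi>: "\<And>w. w \<in> W \<Longrightarrow> blinfun_apply \<phi> w = 0" "norm \<phi> \<le> 1"
    "blinfun_apply \<phi> z = infdist z W"
    using hahn_banach_infdist[OF W] by blast
  have "\<phi> \<in> span G"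
    using \<phi>(1) by (intro vanishing_on_common_kernel_in_span[OF G]) (auto simp: W_def)
  with z \<phi>(3) have "infdist z W = blinfun_apply \<Phi> \<phi>" by simp
  also have "\<dots> \<le> norm \<Phi> * norm \<phi>" using norm_blinfun[of \<Phi> \<phi>] by simp
  also have "\<dots> \<le> norm \<Phi>" using \<phi>(2) by (simp add: mult_left_le)
  also note M
  finally have "(INF w\<in>W. dist z w) < M"
    using subspace_0[OF W] by (auto simp: infdist_def split: if_splits)
  \<comment> \<open>Subtracting an element of the common kernel keeps the interpolated values, and a
    nearly closest one brings the norm below \<open>M\<close>.\<close>
  then obtain w where w: "w \<in> W" "dist z w < M"
    using subspace_0[OF W] by (subst (asm) cINF_less_iff) (auto intro: bdd_belowI2[where m = 0])
  show thesis
  proof (rule that)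
    show "blinfun_apply f (z - w) = blinfun_apply \<Phi> f" if "f \<in> G" for f
      using that w(1) z[of f] by (simp add: W_def span_base blinfun.diff_right)
    show "norm (z - w) < M" using w(2) by (simp add: dist_norm)
  qed
qed

section \<open>The bidual embedding and James's criterion for non-reflexivity\<close>

lemma norm_bidual_embedding:
  fixes x :: "'a::real_normed_vector"
  shows "norm (bidual_embedding x) = norm x"
proof (rule antisym)
  show "norm (bidual_embedding x) \<le> norm x"
  proof (rule norm_blinfun_bound)
    fix \<phi> :: "'a \<Rightarrow>\<^sub>L real"
    show "norm (blinfun_apply (bidual_embedding x) \<phi>) \<le> norm x * norm \<phi>"
      using norm_blinfun[of \<phi> x] by (simp add: mult.commute)
  qed simp
  obtain \<phi> :: "'a \<Rightarrow>\<^sub>L real" where \<phi>: "norm \<phi> \<le> 1" "blinfun_apply \<phi> x = norm x"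
    using hahn_banach_infdist[OF subspace_single_0, of x] by (auto simp: infdist_singleton)
  have "norm x \<le> norm (bidual_embedding x) * norm \<phi>"
    using norm_blinfun[of "bidual_embedding x" \<phi>] \<phi>(2) by simp
  also have "\<dots> \<le> norm (bidual_embedding x)" using \<phi>(1) by (simp add: mult_left_le)
  finally show "norm x \<le> norm (bidual_embedding x)" .
qed

lemma linear_bidual_embedding:
  "linear (bidual_embedding :: 'a::real_normed_vector \<Rightarrow> ('a \<Rightarrow>\<^sub>L real) \<Rightarrow>\<^sub>L real)"
  by (rule linearI) (auto intro!: blinfun_eqI
      simp: blinfun.add_left blinfun.add_right blinfun.scaleR_left blinfun.scaleR_right)

lemma closed_range_bidual_embedding:
  "closed (range (bidual_embedding :: 'a::banach \<Rightarrow> ('a \<Rightarrow>\<^sub>L real) \<Rightarrow>\<^sub>L real))"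
proof (rule complete_imp_closed, rule complete_isometric_image[where e = 1])
  show "bounded_linear (bidual_embedding :: 'a \<Rightarrow> ('a \<Rightarrow>\<^sub>L real) \<Rightarrow>\<^sub>L real)"
    by (rule bounded_linear_intro[where K = 1])
      (simp_all add: linear_add linear_scale linear_bidual_embedding norm_bidual_embedding)
qed (auto simp: norm_bidual_embedding complete_UNIV)

text \<open>By a theorem of James, a Banach space is non-reflexive exactly when it carries such a
  bounded triangular system.\<close>

definition james_triangle :: "(nat \<Rightarrow> 'a::real_normed_vector) \<Rightarrow> (nat \<Rightarrow> 'a \<Rightarrow>\<^sub>L real) \<Rightarrow> real \<Rightarrow> bool" where
  "james_triangle x g C \<longleftrightarrow>
     (\<forall>i. norm (x i) \<le> C \<and> norm (g i) \<le> C) \<and>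
     (\<forall>i j. blinfun_apply (g i) (x j) = (if i \<le> j then 1 else 0))"

lemma nonreflexive_james_triangle:
  assumes "\<not> reflexive_space TYPE('a::banach)"
  obtains x :: "nat \<Rightarrow> 'a::banach" and g C where "james_triangle x g C"
proof -
  let ?J = "bidual_embedding :: 'a \<Rightarrow> ('a \<Rightarrow>\<^sub>L real) \<Rightarrow>\<^sub>L real"
  obtain \<Phi> where \<Phi>: "\<Phi> \<notin> range ?J"
    using assms by (auto simp: reflexive_space_def surj_def)
  have subJ: "subspace (range ?J)"
    using linear_subspace_image[OF linear_bidual_embedding subspace_UNIV] .
  define d where "d = infdist \<Phi> (range ?J)"
  have d: "d > 0"
    using \<Phi> in_closed_iff_infdist_zero[OF closed_range_bidual_embedding, of \<Phi>]
      infdist_nonneg[of \<Phi> "range ?J"] by (force simp: d_def)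
  obtain \<Theta> where \<Theta>: "\<And>w. w \<in> range ?J \<Longrightarrow> blinfun_apply \<Theta> w = 0" "blinfun_apply \<Theta> \<Phi> = d"
    unfolding d_def using hahn_banach_infdist[OF subJ, of \<Phi>] by blast
  \<comment> \<open>An element of the third dual that vanishes on the embedded space and is
    \<open>1\<close> at \<open>\<Phi>\<close>.\<close>
  define \<Psi> where "\<Psi> = (1 / d) *\<^sub>R \<Theta>"
  have \<Psi>: "blinfun_apply \<Psi> (?J x) = 0" "blinfun_apply \<Psi> \<Phi> = 1" for x
    using \<Theta> d by (auto simp: \<Psi>_def blinfun.scaleR_left)
  define C where "C = max (norm \<Phi>) (norm \<Psi>) + 1"
  \<comment> \<open>The invariant also records that \<open>\<Phi>\<close> is \<open>1\<close> on
    each chosen functional, since every later vector copies the values of \<open>\<Phi>\<close> on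
    the earlier functionals.\<close>
  define P where "P f n r \<longleftrightarrow> norm (fst r) \<le> C \<and> norm (snd r) \<le> C \<and> blinfun_apply \<Phi> (snd r) = 1 \<and>
      blinfun_apply (snd r) (fst r) = 1 \<and>
      (\<forall>j<n. blinfun_apply (snd r) (fst (f j)) = 0 \<and> blinfun_apply (snd (f j)) (fst r) = 1)"
    for f :: "nat \<Rightarrow> 'a \<times> ('a \<Rightarrow>\<^sub>L real)" and n r
  have "\<exists>f. \<forall>n. P f n (f n)"
  proof (rule dependent_wf_choice[OF wf_less])
    show "P f n r = P h n r" if "\<And>z. (z, n) \<in> {(x, y). x < y} \<Longrightarrow> f z = h z" for f h n r
      using that by (auto simp: P_def)
  next
    fix n and f :: "nat \<Rightarrow> 'a \<times> ('a \<Rightarrow>\<^sub>L real)"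
    assume IH: "\<And>y. (y, n) \<in> {(x, y). x < y} \<Longrightarrow> P f y (f y)"
    \<comment> \<open>Helly in the dual: the new functional imitates \<open>\<Psi>\<close>, so
      \<open>\<Phi>\<close> is \<open>1\<close> on it while it vanishes at the old vectors.\<close>
    obtain g :: "'a \<Rightarrow>\<^sub>L real" where
      g: "\<And>h. h \<in> insert \<Phi> ((\<lambda>j. ?J (fst (f j))) ` {..<n}) \<Longrightarrow> blinfun_apply h g = blinfun_apply \<Psi> h"
        "norm g < C"
      by (rule helly_interpolation[of "insert \<Phi> ((\<lambda>j. ?J (fst (f j))) ` {..<n})" \<Psi> C])
        (auto simp: C_def)
    have g1: "blinfun_apply \<Phi> g = 1" using g(1)[of \<Phi>] \<Psi> by simp
    have g0: "blinfun_apply g (fst (f j)) = 0" if "j < n" for j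
      using g(1)[of "?J (fst (f j))"] \<Psi> that by simp
    \<comment> \<open>Helly in the space: the new vector imitates \<open>\<Phi>\<close>, which is
      \<open>1\<close> on the old functionals and on the new one.\<close>
    obtain x where x: "\<And>h. h \<in> insert g ((\<lambda>j. snd (f j)) ` {..<n}) \<Longrightarrow> blinfun_apply h x = blinfun_apply \<Phi> h"
        "norm x < C"
      by (rule helly_interpolation[of "insert g ((\<lambda>j. snd (f j)) ` {..<n})" \<Phi> C])
        (auto simp: C_def)
    have "blinfun_apply \<Phi> (snd (f j)) = 1" if "j < n" for j
      using IH[of j] that by (simp add: P_def)
    then have "P f n (x, g)"
      using g1 g0 x g(2) by (simp add: P_def)
    then show "\<exists>r. P f n r" ..
  qed
  then obtain f where f: "\<And>n. P f n (f n)" by blast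
  have "blinfun_apply (snd (f i)) (fst (f j)) = (if i \<le> j then 1 else 0)" for i j
    using f[of i] f[of j] by (cases i j rule: linorder_cases) (auto simp: P_def)
  then have "james_triangle (\<lambda>i. fst (f i)) (\<lambda>i. snd (f i)) C"
    using f by (auto simp: james_triangle_def P_def)
  then show thesis by (rule that)
qed

section \<open>Almost flat systems of vectors\<close>

lemma ramsey_stabilization:
  fixes \<kappa> :: "(nat \<Rightarrow> nat) \<Rightarrow> real"
  assumes dep: "\<And>p q. (\<And>i. i < r \<Longrightarrow> p i = q i) \<Longrightarrow> \<kappa> p = \<kappa> q"
    and bnd: "\<And>p. strict_mono p \<Longrightarrow> 0 \<le> \<kappa> p \<and> \<kappa> p \<le> B"
    and eps: "\<epsilon> > 0" and Z: "infinite Z"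
  obtains Y c where "Y \<subseteq> Z" "infinite Y"
    "\<And>p. strict_mono p \<Longrightarrow> range p \<subseteq> Y \<Longrightarrow> c \<le> \<kappa> p \<and> \<kappa> p \<le> c + \<epsilon>"
proof -
  define s where "s = nat \<lfloor>B / \<epsilon>\<rfloor>"
  \<comment> \<open>An \<open>r\<close>-element set is coloured by the interval of length
    \<open>\<epsilon>\<close> that contains the value of \<open>\<kappa>\<close> on its increasing
    enumeration. The list is unspecified beyond its length, so the bound on \<open>\<kappa>\<close>
    does not apply directly; \<open>min s\<close> keeps the number of colours finite.\<close>
  define col where "col X = min s (nat \<lfloor>\<kappa> (\<lambda>i. sorted_list_of_set X ! i) / \<epsilon>\<rfloor>)" for X
  have "\<forall>X. X \<subseteq> Z \<and> finite X \<and> card X = r \<longrightarrow> col X < Suc s"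
    by (simp add: col_def less_Suc_eq_le)
  from Ramsey[OF Z this] obtain Y t where Y: "Y \<subseteq> Z" "infinite Y"
    and t: "\<forall>X. X \<subseteq> Y \<and> finite X \<and> card X = r \<longrightarrow> col X = t"
    by (elim exE conjE)
  have "real t * \<epsilon> \<le> \<kappa> p \<and> \<kappa> p \<le> real t * \<epsilon> + \<epsilon>" if p: "strict_mono p" "range p \<subseteq> Y" for p
  proof -
    let ?X = "p ` {..<r}"
    have "sorted_list_of_set ?X = map p [0..<r]"
    proof (rule sorted_distinct_set_unique)
      show "sorted (map p [0..<r])"
        using p(1) by (auto simp: sorted_iff_nth_mono strict_mono_less_eq)
      show "distinct (map p [0..<r])"
        using strict_mono_imp_inj_on[OF p(1)] by (auto simp: distinct_map intro: inj_on_subset)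
      show "set (sorted_list_of_set ?X) = set (map p [0..<r])" by auto
    qed auto
    then have "\<kappa> (\<lambda>i. sorted_list_of_set ?X ! i) = \<kappa> p" by (intro dep) simp
    moreover have "card ?X = r"
      using strict_mono_imp_inj_on[OF p(1)] by (subst card_image) (auto intro: inj_on_subset)
    moreover have "nat \<lfloor>\<kappa> p / \<epsilon>\<rfloor> \<le> s"
      unfolding s_def using bnd[OF p(1)] eps by (intro nat_mono floor_mono divide_right_mono) auto
    moreover have "?X \<subseteq> Y" using p(2) by auto
    ultimately have "nat \<lfloor>\<kappa> p / \<epsilon>\<rfloor> = t"
      using spec[OF t, of ?X] by (simp add: col_def)
    moreover have "\<kappa> p / \<epsilon> \<ge> 0" using bnd[OF p(1)] eps by simp
    ultimately have "real t \<le> \<kappa> p / \<epsilon>" "\<kappa> p / \<epsilon> \<le> real t + 1" by linarith+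
    then show ?thesis using eps by (simp add: field_simps)
  qed
  with Y show thesis using that[of Y "real t * \<epsilon>"] by simp
qed

lemma ramsey_stabilization_upto:
  fixes \<kappa> :: "nat \<Rightarrow> (nat \<Rightarrow> nat) \<Rightarrow> real" and N :: nat
  assumes dep: "\<And>n p q. (\<And>i. i < r n \<Longrightarrow> p i = q i) \<Longrightarrow> \<kappa> n p = \<kappa> n q"
    and bnd: "\<And>n p. strict_mono p \<Longrightarrow> 0 \<le> \<kappa> n p \<and> \<kappa> n p \<le> B n"
    and eps: "\<epsilon> > 0"
  shows "\<exists>Y c. infinite Y \<and> (\<forall>n<N. \<forall>p. strict_mono p \<longrightarrow> range p \<subseteq> Y \<longrightarrow>
    c n \<le> \<kappa> n p \<and> \<kappa> n p \<le> c n + \<epsilon>)"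
proof (induction N)
  case 0
  show ?case by (auto intro!: exI[of _ UNIV])
next
  case (Suc N)
  then obtain Y c where Y: "infinite Y" and c: "\<And>n p. n < N \<Longrightarrow> strict_mono p \<Longrightarrow> range p \<subseteq> Y \<Longrightarrow>
    c n \<le> \<kappa> n p \<and> \<kappa> n p \<le> c n + \<epsilon>" by blast
  obtain Y' c' where Y': "Y' \<subseteq> Y" "infinite Y'"
    and c': "\<And>p. strict_mono p \<Longrightarrow> range p \<subseteq> Y' \<Longrightarrow> c' \<le> \<kappa> N p \<and> \<kappa> N p \<le> c' + \<epsilon>"
    by (rule ramsey_stabilization[of "r N" "\<kappa> N" "B N", OF dep bnd eps Y]) blast+
  have "(c(N := c')) n \<le> \<kappa> n p \<and> \<kappa> n p \<le> (c(N := c')) n + \<epsilon>"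
    if "n < Suc N" "strict_mono p" "range p \<subseteq> Y'" for n p
    using c[of n p] c'[of p] that Y'(1) by (cases "n = N") auto
  with Y'(2) show ?case by (intro exI[of _ Y'] exI[of _ "c(N := c')"]) auto
qed

lemma linear_less_power:
  fixes \<rho> A :: real
  assumes "\<rho> > 1"
  shows "\<exists>n::nat. A * (real n + 1) < \<rho> ^ n"
proof -
  have x: "norm (1 / \<rho>) < 1" using assms by simp
  have "(\<lambda>n. A * (real n * (1 / \<rho>) ^ n + (1 / \<rho>) ^ n)) \<longlonglongrightarrow> A * (0 + 0)"
    using assms by (intro tendsto_intros powser_times_n_limit_0[OF x] LIMSEQ_realpow_zero) auto
  then have "\<forall>\<^sub>F n in sequentially. A * (real n * (1 / \<rho>) ^ n + (1 / \<rho>) ^ n) < 1"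
    by (rule order_tendstoD) simp
  then obtain n where "A * (real n * (1 / \<rho>) ^ n + (1 / \<rho>) ^ n) < 1"
    by (auto simp: eventually_sequentially)
  then show ?thesis using assms by (intro exI[of _ n]) (simp add: field_simps)
qed

text \<open>If every step failed, \<open>c\<close> would grow at least by a fixed factor
  \<open>\<rho> > 1\<close> each time and outgrow its linear bound. The numbers
  \<open>\<epsilon>\<close> and \<open>N\<close> come before \<open>c\<close>, because the Ramsey
  stabilization that produces \<open>c\<close> takes them as input.\<close>

lemma slow_growth_step:
  fixes \<theta> a b :: real
  assumes th: "0 < \<theta>" "\<theta> < 1" and a: "a > 0"
  shows "\<exists>\<epsilon>>0. \<exists>N. \<forall>c. (\<forall>n. 1 \<le> n \<and> n < N \<longrightarrow> a - \<epsilon> \<le> c n \<and> c n \<le> b * real n) \<longrightarrow>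
       (\<exists>n\<ge>1. Suc n < N \<and> \<theta> * (c (Suc n) + 2 * \<epsilon>) \<le> c n)"
proof -
  \<comment> \<open>With this choice \<open>\<rho>\<close> is the midpoint of \<open>1\<close> and
    \<open>1 / \<theta>\<close>.\<close>
  define \<sigma> where "\<sigma> = (1 / \<theta> - 1) / 2"
  define \<rho> where "\<rho> = 1 / \<theta> - \<sigma>"
  have \<sigma>: "\<sigma> > 0" using th by (simp add: \<sigma>_def field_simps)
  have \<rho>: "\<rho> > 1" using th by (simp add: \<rho>_def \<sigma>_def field_simps)
  \<comment> \<open>The first bound makes the growth start at \<open>a / 2\<close> or more; the
    second lets \<open>\<sigma> * c (Suc k)\<close> absorb the error
    \<open>2 * \<epsilon>\<close>.\<close>
  define \<epsilon> where "\<epsilon> = min (a / 2) (\<sigma> * a / 4)"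
  have \<epsilon>: "\<epsilon> > 0" "\<epsilon> \<le> a / 2" "\<epsilon> \<le> \<sigma> * a / 4" using a \<sigma> by (auto simp: \<epsilon>_def)
  obtain M where M: "(2 / a * b) * (real M + 1) < \<rho> ^ M" using linear_less_power[OF \<rho>] by blast
  have "\<exists>n\<ge>1. Suc n < M + 2 \<and> \<theta> * (c (Suc n) + 2 * \<epsilon>) \<le> c n"
    if c: "\<And>n. 1 \<le> n \<Longrightarrow> n < M + 2 \<Longrightarrow> a - \<epsilon> \<le> c n \<and> c n \<le> b * real n" for c
  proof (rule ccontr)
    assume "\<not> ?thesis"
    then have neg: "c n < \<theta> * (c (Suc n) + 2 * \<epsilon>)" if "1 \<le> n" "Suc n < M + 2" for n
      using that by (meson not_le)
    have "a / 2 * \<rho> ^ k \<le> c (Suc k)" if "k \<le> M" for k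
      using that
    proof (induction k)
      case 0
      then show ?case using c[of 1] \<epsilon> by simp
    next
      case (Suc k)
      then have IH: "a / 2 * \<rho> ^ k \<le> c (Suc k)" by simp
      have "a / 2 * 1 \<le> a / 2 * \<rho> ^ k" using a \<rho> by (intro mult_left_mono one_le_power) auto
      with IH have "a / 2 \<le> c (Suc k)" by simp
      then have "\<sigma> * (a / 2) \<le> \<sigma> * c (Suc k)" using \<sigma> by (intro mult_left_mono) auto
      with \<epsilon>(3) have s: "2 * \<epsilon> \<le> \<sigma> * c (Suc k)" by simp
      have "c (Suc k) < \<theta> * (c (Suc (Suc k)) + 2 * \<epsilon>)"
        using Suc.prems by (intro neg) auto
      then have "1 / \<theta> * c (Suc k) < c (Suc (Suc k)) + 2 * \<epsilon>" using th by (simp add: field_simps)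
      with s have "\<rho> * c (Suc k) \<le> c (Suc (Suc k))" by (simp add: \<rho>_def algebra_simps)
      moreover have "\<rho> * (a / 2 * \<rho> ^ k) \<le> \<rho> * c (Suc k)" using IH \<rho> by (intro mult_left_mono) auto
      moreover have "a / 2 * \<rho> ^ Suc k = \<rho> * (a / 2 * \<rho> ^ k)" by simp
      ultimately show ?case by linarith
    qed
    from this[of M] c[of "Suc M"] have "a / 2 * \<rho> ^ M \<le> b * (real M + 1)" by (simp add: add.commute)
    with M a show False by (simp add: field_simps)
  qed
  with \<epsilon>(1) show ?thesis by blast
qed

section \<open>Vectors with alternating values on successive intervals\<close>

definition alternating ::
  "(nat \<Rightarrow> 'a::real_normed_vector \<Rightarrow>\<^sub>L real) \<Rightarrow> nat \<Rightarrow> (nat \<Rightarrow> nat) \<Rightarrow> 'a set" where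
  "alternating g n p =
     {z. \<forall>l<n. \<forall>i. p (2 * l) < i \<and> i \<le> p (Suc (2 * l)) \<longrightarrow> blinfun_apply (g i) z = (-1) ^ l}"

lemma alternatingD:
  "z \<in> alternating g n p \<Longrightarrow> l < n \<Longrightarrow> p (2 * l) < i \<Longrightarrow> i \<le> p (Suc (2 * l)) \<Longrightarrow>
    blinfun_apply (g i) z = (-1) ^ l"
  by (simp add: alternating_def)

lemma alternating_cong:
  assumes "\<And>i. i < 2 * n \<Longrightarrow> p i = q i"
  shows "alternating g n p = alternating g n q"
  unfolding alternating_def using assms by (intro Collect_cong all_cong1) auto

text \<open>In a James triangle, \<open>x b - x a\<close> with \<open>a < b\<close> has value
  \<open>1\<close> under \<open>g i\<close> exactly for \<open>a < i\<close> and
  \<open>i \<le> b\<close>, and \<open>0\<close> otherwise; this explains the half-open intervals.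
  The witness makes the infimum of the norms meaningful and at most linear in
  \<open>n\<close>.\<close>

lemma alternating_witness:
  assumes tri: "james_triangle x g C" and p: "strict_mono p"
  shows "(\<Sum>l<n. (-1) ^ l *\<^sub>R (x (p (Suc (2 * l))) - x (p (2 * l)))) \<in> alternating g n p" (is "?w \<in> _")
    and "norm (\<Sum>l<n. (-1) ^ l *\<^sub>R (x (p (Suc (2 * l))) - x (p (2 * l)))) \<le> 2 * C * real n"
proof -
  have "blinfun_apply (g i) ?w = (-1) ^ l"
    if "l < n" "p (2 * l) < i" "i \<le> p (Suc (2 * l))" for l i
  proof -
    have *: "blinfun_apply (g i) (x (p (Suc (2 * k))) - x (p (2 * k))) = (if k = l then 1 else 0)" for k
    proof -
      have e: "i \<le> p (2 * k) \<longleftrightarrow> l < k"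
        using that strict_mono_less_eq[OF p, of "Suc (2 * l)" "2 * k"]
          strict_mono_less_eq[OF p, of "2 * k" "2 * l"] by auto
      have o: "i \<le> p (Suc (2 * k)) \<longleftrightarrow> l \<le> k"
        using that strict_mono_less_eq[OF p, of "Suc (2 * l)" "Suc (2 * k)"]
          strict_mono_less_eq[OF p, of "Suc (2 * k)" "2 * l"] by auto
      show ?thesis
        using tri e o by (auto simp: james_triangle_def blinfun.diff_right)
    qed
    then show ?thesis
      using that(1) by (simp add: blinfun.sum_right blinfun.scaleR_right * if_distrib[of "(*) _"] cong: if_cong)
  qed
  then show "?w \<in> alternating g n p" by (auto simp: alternating_def)
  have "norm ?w \<le> (\<Sum>l<n. norm ((-1) ^ l *\<^sub>R (x (p (Suc (2 * l))) - x (p (2 * l)))))" by (rule norm_sum)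
  also have "\<dots> \<le> (\<Sum>l<n. 2 * C)"
  proof (rule sum_mono)
    fix l
    have "norm (x (p (Suc (2 * l))) - x (p (2 * l))) \<le> C + C"
      using tri by (intro norm_triangle_le_diff add_mono) (auto simp: james_triangle_def)
    then show "norm ((-1) ^ l *\<^sub>R (x (p (Suc (2 * l))) - x (p (2 * l)))) \<le> 2 * C" by simp
  qed
  finally show "norm ?w \<le> 2 * C * real n" by (simp add: mult.commute)
qed

lemma alternating_norm_lower:
  assumes tri: "james_triangle x g C" and p: "strict_mono p" and n: "n \<ge> 1"
    and z: "z \<in> alternating g n p"
  shows "1 \<le> C * norm z"
proof -
  have "p 0 < p 1" using p by (simp add: strict_mono_less)
  then have "blinfun_apply (g (p 1)) z = 1"
    using alternatingD[OF z, of 0 "p 1"] n by simp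
  then have "1 \<le> norm (g (p 1)) * norm z" using norm_blinfun[of "g (p 1)" z] by simp
  also have "\<dots> \<le> C * norm z" using tri by (intro mult_right_mono) (auto simp: james_triangle_def)
  finally show ?thesis .
qed

text \<open>The \<open>l\<close>-th interval of \<open>z j\<close> covers the slots \<open>(y (2 * t), y (2 * t + 1)]\<close> with
  \<open>l * m + j \<le> t < (l + 1) * m + j\<close>. Hence on the slot \<open>t = (l + 1) * m + r\<close> the vectors with \<open>j \<le> r\<close>
  are in their interval \<open>l + 1\<close> and the others still in their interval \<open>l\<close>, with opposite signs.\<close>

lemma alternating_uminus_average:
  fixes z :: "nat \<Rightarrow> 'a::real_normed_vector"
  assumes y: "strict_mono y" and m: "m \<ge> 1" and r: "r < m"
    and z: "\<And>j. j < m \<Longrightarrow> z j \<in> alternating g (Suc n)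
      (\<lambda>i. y (2 * ((i div 2) * m + j) + (if odd i then 2 * m - 1 else 0)))"
  shows "- ((1 / real m) *\<^sub>R (\<Sum>j<m. (if j < Suc r then 1 else -1) *\<^sub>R z j)) \<in>
    alternating g n (\<lambda>i. y (2 * (Suc (i div 2) * m + r) + (if odd i then 1 else 0)))"
  unfolding alternating_def
proof (intro CollectI allI impI, elim conjE)
  fix l i assume l: "l < n"
  assume i1: "y (2 * (Suc (2 * l div 2) * m + r) + (if odd (2 * l) then 1 else 0)) < i"
    and i2: "i \<le> y (2 * (Suc (Suc (2 * l) div 2) * m + r) + (if odd (Suc (2 * l)) then 1 else 0))"
  have mono: "y a \<le> y b" if "a \<le> b" for a b using y that by (simp add: strict_mono_less_eq)
  have "blinfun_apply (g i) ((if j < Suc r then 1 else -1) *\<^sub>R z j) = - ((-1) ^ l)" if j: "j < m" for j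
  proof (cases "j < Suc r")
    case True
    have "y (2 * (Suc l * m + j)) \<le> y (2 * (Suc l * m + r))" using True by (intro mono) auto
    moreover have "y (2 * (Suc l * m + r) + 1) \<le> y (2 * (Suc l * m + j) + (2 * m - 1))"
      using r by (intro mono) auto
    ultimately have "blinfun_apply (g i) (z j) = (-1) ^ Suc l"
      using l i1 i2 by (intro alternatingD[OF z[OF j]]) auto
    with True show ?thesis by (simp add: blinfun.scaleR_right)
  next
    case False
    have "y (2 * (l * m + j)) \<le> y (2 * (Suc l * m + r))" using j by (intro mono) auto
    moreover have "y (2 * (Suc l * m + r) + 1) \<le> y (2 * (l * m + j) + (2 * m - 1))"
      using False j by (intro mono) auto
    ultimately have "blinfun_apply (g i) (z j) = (-1) ^ l"
      using l i1 i2 by (intro alternatingD[OF z[OF j]]) auto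
    with False show ?thesis by (simp add: blinfun.minus_right)
  qed
  then show "blinfun_apply (g i) (- ((1 / real m) *\<^sub>R (\<Sum>j<m. (if j < Suc r then 1 else -1) *\<^sub>R z j))) = (-1) ^ l"
    using m by (simp add: blinfun.minus_right blinfun.scaleR_right blinfun.sum_right)
qed

lemma strict_mono_by_pairs:
  fixes f :: "nat \<Rightarrow> nat"
  assumes "\<And>l. f (2 * l) < f (Suc (2 * l))" "\<And>l. f (Suc (2 * l)) < f (2 * Suc l)"
  shows "strict_mono f"
  unfolding strict_mono_Suc_iff
proof
  fix i :: nat
  obtain l where "i = 2 * l \<or> i = Suc (2 * l)" by (metis oddE evenE Suc_eq_plus1)
  then show "f i < f (Suc i)" using assms[of l] by auto
qed

section \<open>Extraction of almost flat systems\<close>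

definition almost_flat :: "nat \<Rightarrow> real \<Rightarrow> (nat \<Rightarrow> 'a::real_normed_vector) \<Rightarrow> bool" where
  "almost_flat m \<delta> x \<longleftrightarrow> (\<forall>j<m. norm (x j) \<le> 1) \<and>
     (\<forall>k\<le>m. real m - \<delta> \<le> norm (\<Sum>j<m. (if j < k then 1 else -1) *\<^sub>R x j))"

text \<open>The sign pattern for \<open>k = 0\<close> is the negative of the one for
  \<open>k = m\<close>, so only \<open>k = Suc r\<close> has to be checked.\<close>

lemma almost_flatI:
  assumes "\<And>j. j < m \<Longrightarrow> norm (x j) \<le> 1"
    and "\<And>r. r < m \<Longrightarrow> real m - \<delta> \<le> norm (\<Sum>j<m. (if j < Suc r then 1 else -1) *\<^sub>R x j)"
    and "\<delta> \<ge> 0"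
  shows "almost_flat m \<delta> x"
proof -
  have "real m - \<delta> \<le> norm (\<Sum>j<m. (if j < k then 1 else -1) *\<^sub>R x j)" if "k \<le> m" for k
  proof (cases k)
    case (Suc r)
    with assms(2)[of r] that show ?thesis by simp
  next
    case 0
    show ?thesis
    proof (cases m)
      case (Suc r)
      then have "real m - \<delta> \<le> norm (\<Sum>j<m. x j)" using assms(2)[of r] by simp
      then show ?thesis using 0 by (simp add: sum_negf)
    qed (use assms(3) in simp)
  qed
  with assms(1) show ?thesis by (simp add: almost_flat_def)
qed

lemma james_triangle_almost_flat:
  fixes x :: "nat \<Rightarrow> 'a::real_normed_vector"
  assumes tri: "james_triangle x g C" and m: "m \<ge> 1" and \<delta>: "\<delta> > 0"
  obtains z :: "nat \<Rightarrow> 'a" where "almost_flat m \<delta> z"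
proof -
  \<comment> \<open>The maximum with \<open>1 / 2\<close> keeps \<open>\<theta>\<close> positive
    when \<open>\<delta>\<close> exceeds \<open>m\<close>.\<close>
  define \<theta> where "\<theta> = max (1 - \<delta> / real m) (1 / 2)"
  have \<theta>: "0 < \<theta>" "\<theta> < 1" "real m - \<delta> \<le> real m * \<theta>"
    using m \<delta> by (auto simp: \<theta>_def field_simps max_def)
  have C: "C > 0"
  proof -
    have "0 \<le> norm (x 0)" "norm (x 0) \<le> C" using tri by (auto simp: james_triangle_def)
    moreover have "1 \<le> C * norm (x 0)"
    proof -
      have "1 \<le> norm (g 0) * norm (x 0)"
        using norm_blinfun[of "g 0" "x 0"] tri by (simp add: james_triangle_def)
      also have "\<dots> \<le> C * norm (x 0)"
        using tri by (intro mult_right_mono) (auto simp: james_triangle_def)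
      finally show ?thesis .
    qed
    ultimately show ?thesis by (metis less_eq_real_def mult_zero_left not_one_le_zero order_trans)
  qed
  define \<kappa> where "\<kappa> n p = (INF z\<in>alternating g n p. norm z)" for n p
  have bdd: "bdd_below (norm ` alternating g n p)" for n p
    by (rule bdd_belowI2[where m = 0]) simp
  have \<kappa>_le: "\<kappa> n p \<le> norm z" if "z \<in> alternating g n p" for n p z
    unfolding \<kappa>_def by (rule cINF_lower[OF bdd that])
  have ne: "alternating g n p \<noteq> {}" if "strict_mono p" for n p
    using alternating_witness(1)[OF tri that] by blast
  have \<kappa>_ub: "\<kappa> n p \<le> 2 * C * real n" if "strict_mono p" for n p
    using \<kappa>_le[OF alternating_witness(1)[OF tri that]] alternating_witness(2)[OF tri that]
    by (rule order_trans)
  have \<kappa>_nonneg: "0 \<le> \<kappa> n p" if "strict_mono p" for n p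
    unfolding \<kappa>_def by (rule cINF_greatest[OF ne[OF that]]) simp
  have \<kappa>_lb: "1 / C \<le> \<kappa> n p" if "strict_mono p" "n \<ge> 1" for n p
    unfolding \<kappa>_def
    by (rule cINF_greatest[OF ne[OF that(1)]])
      (use alternating_norm_lower[OF tri that] C in \<open>auto simp: field_simps\<close>)
  obtain \<epsilon> N where \<epsilon>: "\<epsilon> > 0"
    and step: "\<forall>c. (\<forall>n. 1 \<le> n \<and> n < N \<longrightarrow> 1 / C - \<epsilon> \<le> c n \<and> c n \<le> 2 * C * real n) \<longrightarrow>
       (\<exists>n\<ge>1. Suc n < N \<and> \<theta> * (c (Suc n) + 2 * \<epsilon>) \<le> c n)"
    using slow_growth_step[OF \<theta>(1,2), of "1 / C" "2 * C"] C by auto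
  have "\<exists>Y c. infinite Y \<and> (\<forall>n<N. \<forall>p. strict_mono p \<longrightarrow> range p \<subseteq> Y \<longrightarrow>
    c n \<le> \<kappa> n p \<and> \<kappa> n p \<le> c n + \<epsilon>)"
  proof (rule ramsey_stabilization_upto[where r = "\<lambda>n. 2 * n" and B = "\<lambda>n. 2 * C * real n", OF _ _ \<epsilon>])
    show "\<kappa> n p = \<kappa> n q" if "\<And>i. i < 2 * n \<Longrightarrow> p i = q i" for n p q
      unfolding \<kappa>_def using alternating_cong[of n p q g] that by simp
  qed (use \<kappa>_ub \<kappa>_nonneg in auto)
  then obtain Y c where Y: "infinite Y" and c: "\<And>n p. n < N \<Longrightarrow> strict_mono p \<Longrightarrow> range p \<subseteq> Y \<Longrightarrow>
    c n \<le> \<kappa> n p \<and> \<kappa> n p \<le> c n + \<epsilon>" by blast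
  define y where "y = enumerate Y"
  have y: "strict_mono y" using Y by (simp add: y_def strict_mono_enumerate)
  have yY: "y i \<in> Y" for i using Y by (simp add: y_def enumerate_in_set)
  have "1 / C - \<epsilon> \<le> c n \<and> c n \<le> 2 * C * real n" if "1 \<le> n" "n < N" for n
    using c[OF that(2) y] yY \<kappa>_lb[OF y that(1)] \<kappa>_ub[OF y, of n] by fastforce
  with step obtain n where n: "n \<ge> 1" "Suc n < N" "\<theta> * (c (Suc n) + 2 * \<epsilon>) \<le> c n" by blast
  \<comment> \<open>One \<open>\<epsilon>\<close> is the Ramsey tolerance; the other makes
    \<open>\<kappa> (Suc n) (p j) < D\<close> strict, so that vectors of norm below \<open>D\<close>
    exist. The choice of \<open>n\<close> says that \<open>\<theta> * D\<close> is at most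
    \<open>c n\<close>.\<close>
  define D where "D = c (Suc n) + 2 * \<epsilon>"
  define p where "p j = (\<lambda>i. y (2 * ((i div 2) * m + j) + (if odd i then 2 * m - 1 else 0)))" for j
  define q where "q r = (\<lambda>i. y (2 * (Suc (i div 2) * m + r) + (if odd i then 1 else 0)))" for r
  have sp: "strict_mono (p j)" for j
    using m by (intro strict_mono_by_pairs) (auto simp: p_def strict_mono_less[OF y])
  have sq: "strict_mono (q r)" for r
    using m by (intro strict_mono_by_pairs) (auto simp: q_def strict_mono_less[OF y])
  have \<kappa>D: "\<kappa> (Suc n) (p j) < D" for j
  proof -
    have "range (p j) \<subseteq> Y" using yY by (auto simp: p_def)
    with c[OF n(2) sp this] \<epsilon> show ?thesis unfolding D_def by linarith
  qed
  have "\<exists>z. z \<in> alternating g (Suc n) (p j) \<and> norm z < D" for j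
    using \<kappa>D[of j] unfolding \<kappa>_def by (subst (asm) cINF_less_iff[OF ne[OF sp] bdd]) auto
  then obtain z where z: "\<And>j. z j \<in> alternating g (Suc n) (p j)" "\<And>j. norm (z j) < D" by metis
  have D: "D > 0" using z(2)[of 0] norm_ge_zero[of "z 0"] by linarith
  \<comment> \<open>Up to sign, the signed average competes in the infimum
    \<open>\<kappa> n (q r)\<close>, which is at least \<open>c n\<close> because \<open>q r\<close>
    also takes its values in \<open>Y\<close>.\<close>
  have lower: "\<theta> * D * real m \<le> norm (\<Sum>j<m. (if j < Suc r then 1 else -1) *\<^sub>R z j)" if r: "r < m" for r
  proof -
    let ?v = "\<Sum>j<m. (if j < Suc r then 1 else -1) *\<^sub>R z j"
    have "- ((1 / real m) *\<^sub>R ?v) \<in> alternating g n (q r)"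
      unfolding q_def by (rule alternating_uminus_average[OF y m r]) (use z(1) in \<open>simp add: p_def\<close>)
    from \<kappa>_le[OF this] have "\<kappa> n (q r) \<le> norm ?v / real m" by simp
    moreover have "c n \<le> \<kappa> n (q r)" using c[of n "q r"] n(2) sq[of r] yY by (auto simp: q_def)
    ultimately have "\<theta> * D \<le> norm ?v / real m" using n(3) by (simp add: D_def)
    then show ?thesis using m by (simp add: field_simps)
  qed
  have "almost_flat m \<delta> (\<lambda>j. (1 / D) *\<^sub>R z j)"
  proof (rule almost_flatI)
    show "norm ((1 / D) *\<^sub>R z j) \<le> 1" for j using z(2)[of j] D by simp
    fix r assume r: "r < m"
    have "(\<Sum>j<m. (if j < Suc r then 1 else -1) *\<^sub>R (1 / D) *\<^sub>R z j) =
        (1 / D) *\<^sub>R (\<Sum>j<m. (if j < Suc r then 1 else -1) *\<^sub>R z j)"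
      by (simp add: scaleR_sum_right mult.commute)
    also have "norm \<dots> = norm (\<Sum>j<m. (if j < Suc r then 1 else -1) *\<^sub>R z j) / D"
      using D by simp
    also have "\<dots> \<ge> real m * \<theta>"
      using lower[OF r] D by (simp add: pos_le_divide_eq mult_ac)
    finally show "real m - \<delta> \<le> norm (\<Sum>j<m. (if j < Suc r then 1 else -1) *\<^sub>R (1 / D) *\<^sub>R z j)"
      using \<theta>(3) by linarith
  qed (use \<delta> in simp)
  then show thesis by (rule that)
qed

section \<open>Transfer through finite representability\<close>

lemma linear_on_subspace_zero:
  "linear_on_subspace F S \<Longrightarrow> 0 \<in> F \<Longrightarrow> S 0 = 0"
  unfolding linear_on_subspace_def by (metis scaleR_zero_left)

lemma linear_on_subspace_sum:
  assumes S: "linear_on_subspace F S" and F: "subspace F" and J: "finite J"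
    and z: "\<And>j. j \<in> J \<Longrightarrow> z j \<in> F"
  shows "S (\<Sum>j\<in>J. c j *\<^sub>R z j) = (\<Sum>j\<in>J. c j *\<^sub>R S (z j))"
  using J z
proof (induction J rule: finite_induct)
  case empty
  then show ?case using linear_on_subspace_zero[OF S subspace_0[OF F]] by simp
next
  case (insert i J)
  have "(\<Sum>j\<in>J. c j *\<^sub>R z j) \<in> F" "c i *\<^sub>R z i \<in> F"
    using insert.prems F by (auto intro!: subspace_sum subspace_scale)
  then show ?case using insert S by (simp add: linear_on_subspace_def)
qed

lemma subspace_linear_on_subspace_image:
  assumes S: "linear_on_subspace F S" and F: "subspace F"
  shows "subspace (S ` F)"
proof (rule subspaceI)
  show "0 \<in> S ` F"
    using linear_on_subspace_zero[OF S] subspace_0[OF F] by force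
next
  fix x y assume "x \<in> S ` F" "y \<in> S ` F"
  then obtain a b where ab: "x = S a" "y = S b" "a \<in> F" "b \<in> F" by auto
  then have "S (a + b) = x + y" using S by (simp add: linear_on_subspace_def)
  with subspace_add[OF F ab(3,4)] show "x + y \<in> S ` F" by (metis image_eqI)
next
  fix c x assume "x \<in> S ` F"
  then obtain a where a: "x = S a" "a \<in> F" by auto
  then have "S (c *\<^sub>R a) = c *\<^sub>R x" using S by (simp add: linear_on_subspace_def)
  with subspace_scale[OF F a(2)] show "c *\<^sub>R x \<in> S ` F" by (metis image_eqI)
qed

lemma linear_on_subspace_image_span:
  assumes S: "linear_on_subspace (span A) S"
  shows "S ` span A = span (S ` A)"
proof
  have "x \<in> span A \<and> S x \<in> span (S ` A)" if "x \<in> span A" for x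
    using that
  proof (induction rule: span_induct_alt)
    case base
    then show ?case using linear_on_subspace_zero[OF S] by (simp add: span_zero)
  next
    case (step c x y)
    have "x \<in> span A" using step(1) by (rule span_base)
    then have "c *\<^sub>R x \<in> span A" "S (c *\<^sub>R x) = c *\<^sub>R S x"
      using S by (auto simp: span_scale linear_on_subspace_def)
    moreover from this have "S (c *\<^sub>R x + y) = c *\<^sub>R S x + S y"
      using S step(2) by (simp add: linear_on_subspace_def)
    moreover have "S x \<in> span (S ` A)" using step(1) by (simp add: span_base)
    ultimately show ?case using step(2) by (simp add: span_add span_scale)
  qed
  then show "S ` span A \<subseteq> span (S ` A)" by auto
  show "span (S ` A) \<subseteq> S ` span A"
    by (intro span_minimal image_mono span_superset subspace_linear_on_subspace_image[OF S]) simp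
qed

lemma linear_on_subspace_inv_into:
  assumes S: "linear_on_subspace F S" and F: "subspace F" and inj: "inj_on S F"
  shows "linear_on_subspace (S ` F) (inv_into F S)"
proof -
  have "inv_into F S (S a + S b) = a + b" if "a \<in> F" "b \<in> F" for a b
  proof -
    have "S (a + b) = S a + S b" using S that by (simp add: linear_on_subspace_def)
    with inv_into_f_f[OF inj subspace_add[OF F that]] show ?thesis by simp
  qed
  moreover have "inv_into F S (c *\<^sub>R S a) = c *\<^sub>R a" if "a \<in> F" for a c
  proof -
    have "S (c *\<^sub>R a) = c *\<^sub>R S a" using S that by (simp add: linear_on_subspace_def)
    with inv_into_f_f[OF inj subspace_scale[OF F that]] show ?thesis by metis
  qed
  ultimately show ?thesis
    by (auto simp: linear_on_subspace_def inv_into_f_f[OF inj])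
qed

text \<open>The supremum defining \<^const>\<open>onorm_on\<close> is an arbitrary value on an unbounded set of quotients;
  boundedness in finite dimension is therefore needed before \<^const>\<open>onorm_on\<close> bounds anything.\<close>

lemma closed_span_finite_linear_bounded:
  fixes A :: "'a::real_normed_vector set"
  assumes "finite A"
  shows "closed (span A) \<and>
    (\<forall>S :: 'a \<Rightarrow> 'b::real_normed_vector. linear_on_subspace (span A) S \<longrightarrow>
       (\<exists>K. \<forall>x\<in>span A. norm (S x) \<le> K * norm x))"
  using assms
proof (induction A rule: finite_induct)
  case empty
  show ?case by (auto simp: linear_on_subspace_zero)
next
  case (insert v A)
  show ?case
  proof (cases "v \<in> span A")
    case True
    then show ?thesis using insert.IH by (simp add: span_redundant)
  next
    case False
    obtain \<phi> :: "'a \<Rightarrow>\<^sub>L real" where \<phi>: "\<And>w. w \<in> span A \<Longrightarrow> blinfun_apply \<phi> w = 0" "norm \<phi> \<le> 1"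
      "blinfun_apply \<phi> v = infdist v (span A)"
      using hahn_banach_infdist[OF subspace_span] by blast
    define d where "d = infdist v (span A)"
    have "span A \<noteq> {}" using span_zero by auto
    then have d: "d > 0"
      using in_closed_iff_infdist_zero[of "span A" v] insert.IH False infdist_nonneg[of v "span A"]
      by (force simp: d_def)
    \<comment> \<open>On the larger span this is the coefficient of \<open>v\<close>. It is
      continuous because the smaller span is closed and so at positive distance from
      \<open>v\<close>; the larger span is then a continuous preimage of the smaller one.\<close>
    define \<tau> where "\<tau> w = blinfun_apply \<phi> w / d" for w
    have split: "w \<in> span (insert v A) \<longleftrightarrow> w - \<tau> w *\<^sub>R v \<in> span A" for w
    proof
      assume "w \<in> span (insert v A)"
      then obtain c where c: "w - c *\<^sub>R v \<in> span A" by (auto simp: span_insert)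
      from \<phi>(1)[OF this] d have "c = \<tau> w"
        by (simp add: blinfun.diff_right blinfun.scaleR_right \<phi>(3) \<tau>_def flip: d_def)
      with c show "w - \<tau> w *\<^sub>R v \<in> span A" by simp
    qed (auto simp: span_insert)
    have \<tau>_le: "\<bar>\<tau> w\<bar> \<le> norm w / d" for w
    proof -
      have "\<bar>blinfun_apply \<phi> w\<bar> \<le> norm \<phi> * norm w" using norm_blinfun[of \<phi> w] by simp
      also have "\<dots> \<le> norm w" using \<phi>(2) by (simp add: mult_right_le_one_le mult_left_le_one_le)
      finally show ?thesis using d by (simp add: \<tau>_def divide_right_mono)
    qed
    have "closed ((\<lambda>w. w - \<tau> w *\<^sub>R v) -` span A)"
      unfolding \<tau>_def using insert.IH d by (intro closed_vimage continuous_intros) auto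
    moreover have "(\<lambda>w. w - \<tau> w *\<^sub>R v) -` span A = span (insert v A)" using split by auto
    moreover have "\<exists>K. \<forall>x\<in>span (insert v A). norm (S x) \<le> K * norm x"
      if S: "linear_on_subspace (span (insert v A)) S" for S :: "'a \<Rightarrow> 'b"
    proof -
      have sub: "span A \<subseteq> span (insert v A)" by (rule span_mono) auto
      then have "linear_on_subspace (span A) S" using S unfolding linear_on_subspace_def by blast
      then obtain K where K: "\<And>x. x \<in> span A \<Longrightarrow> norm (S x) \<le> K * norm x" using insert.IH by blast
      have "norm (S x) \<le> (\<bar>K\<bar> * (1 + norm v / d) + norm (S v) / d) * norm x" if x: "x \<in> span (insert v A)" for x
      proof -
        let ?y = "x - \<tau> x *\<^sub>R v"
        have y: "?y \<in> span A" using split x by simp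
        have v: "\<tau> x *\<^sub>R v \<in> span (insert v A)" "S (\<tau> x *\<^sub>R v) = \<tau> x *\<^sub>R S v"
          using S by (auto simp: span_scale span_base linear_on_subspace_def)
        have "S x = S (?y + \<tau> x *\<^sub>R v)" by simp
        also have "\<dots> = S ?y + \<tau> x *\<^sub>R S v"
          using S y v sub unfolding linear_on_subspace_def by (metis subsetD)
        finally have "norm (S x) \<le> norm (S ?y) + \<bar>\<tau> x\<bar> * norm (S v)"
          by (metis norm_scaleR norm_triangle_ineq)
        moreover have "norm (S ?y) \<le> \<bar>K\<bar> * norm ?y"
          using K[OF y] mult_right_mono[OF abs_ge_self[of K] norm_ge_zero[of ?y]] by linarith
        moreover have "norm ?y \<le> norm x + \<bar>\<tau> x\<bar> * norm v"
          using norm_triangle_ineq4[of x "\<tau> x *\<^sub>R v"] by simp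
        then have "\<bar>K\<bar> * norm ?y \<le> \<bar>K\<bar> * (norm x + norm x / d * norm v)"
          using mult_right_mono[OF \<tau>_le[of x] norm_ge_zero[of v]] by (intro mult_left_mono) auto
        moreover have "\<bar>\<tau> x\<bar> * norm (S v) \<le> norm x / d * norm (S v)"
          by (rule mult_right_mono[OF \<tau>_le norm_ge_zero])
        ultimately show ?thesis by (simp add: algebra_simps)
      qed
      then show ?thesis by blast
    qed
    ultimately show ?thesis by simp
  qed
qed

lemma onorm_on_bound:
  fixes S :: "'a::real_normed_vector \<Rightarrow> 'b::real_normed_vector"
  assumes S: "linear_on_subspace (span A) S" and A: "finite A" and x: "x \<in> span A"
  shows "norm (S x) \<le> onorm_on (span A) S * norm x"
proof -
  obtain K where K: "\<And>x. x \<in> span A \<Longrightarrow> norm (S x) \<le> K * norm x"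
    using closed_span_finite_linear_bounded[OF A, where ?'b = 'b] S by blast
  have "norm (S x) / norm x \<le> \<bar>K\<bar>" if "x \<in> span A" for x
  proof (cases "x = 0")
    case False
    have "norm (S x) \<le> \<bar>K\<bar> * norm x"
      using K[OF that] mult_right_mono[OF abs_ge_self[of K] norm_ge_zero[of x]] by linarith
    with False show ?thesis by (simp add: field_simps)
  qed simp
  then have "norm (S x) / norm x \<le> onorm_on (span A) S"
    unfolding onorm_on_def using x by (intro cSUP_upper bdd_aboveI2) auto
  moreover have "norm (S x) = 0" if "x = 0"
    using linear_on_subspace_zero[OF S] that by (simp add: span_zero)
  ultimately show ?thesis by (cases "x = 0") (auto simp: field_simps)
qed

text \<open>Dividing \<open>S\<close> by its norm \<open>a\<close> keeps the vectors in the unit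
  ball, and the bound on the inverse then costs at most a factor \<open>1 + \<eta>\<close> in the
  lower estimates.\<close>

lemma almost_flat_finitely_representable:
  assumes fr: "finitely_representable TYPE('y::banach) TYPE('x::banach)"
    and z: "almost_flat m (\<delta> / 2) (z :: nat \<Rightarrow> 'y)" and m: "m \<ge> 1" and \<delta>: "\<delta> > 0"
  shows "\<exists>x :: nat \<Rightarrow> 'x. almost_flat m \<delta> x"
proof -
  define A where "A = z ` {..<m}"
  \<comment> \<open>Chosen so that \<open>(1 + \<eta>) * (real m - \<delta>)\<close> is at most
    \<open>real m - \<delta> / 2\<close>.\<close>
  define \<eta> where "\<eta> = \<delta> / (2 * real m)"
  have A: "finite A" by (simp add: A_def)
  have \<eta>: "\<eta> > 0" "real m * \<eta> = \<delta> / 2" using m \<delta> by (auto simp: \<eta>_def)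
  obtain S :: "'y \<Rightarrow> 'x" where S: "linear_on_subspace (span A) S" "inj_on S (span A)"
    "onorm_on (span A) S * onorm_on (S ` span A) (inv_into (span A) S) \<le> 1 + \<eta>"
    using fr[unfolded finitely_representable_def, rule_format, of \<eta> "span A"] \<eta>(1) A by auto
  define a where "a = onorm_on (span A) S"
  define b where "b = onorm_on (S ` span A) (inv_into (span A) S)"
  have up: "norm (S w) \<le> a * norm w" if "w \<in> span A" for w
    unfolding a_def by (rule onorm_on_bound[OF S(1) A that])
  have im: "S ` span A = span (S ` A)" by (rule linear_on_subspace_image_span[OF S(1)])
  have lo: "norm w \<le> b * norm (S w)" if "w \<in> span A" for w
  proof -
    have "linear_on_subspace (span (S ` A)) (inv_into (span A) S)"
      using linear_on_subspace_inv_into[OF S(1) subspace_span S(2)] by (simp add: im)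
    from onorm_on_bound[OF this] A that
    have "norm (inv_into (span A) S (S w)) \<le> b * norm (S w)"
      by (simp add: b_def flip: im)
    with inv_into_f_f[OF S(2) that] show ?thesis by simp
  qed
  have zA: "z j \<in> span A" if "j < m" for j using that by (auto simp: A_def intro: span_base)
  have key: "real m - \<delta> \<le> norm (S w) / a" if w: "w \<in> span A" "real m - \<delta> / 2 \<le> norm w" for w
  proof (cases "a > 0")
    case True
    have "a * norm w \<le> a * b * norm (S w)" using lo[OF w(1)] True by simp
    also have "\<dots> \<le> (1 + \<eta>) * norm (S w)" using S(3) by (intro mult_right_mono) (auto simp: a_def b_def)
    finally have 1: "norm w \<le> (1 + \<eta>) * (norm (S w) / a)" using True by (simp add: field_simps)
    have "(1 + \<eta>) * (real m - \<delta>) = real m + real m * \<eta> - \<delta> - \<eta> * \<delta>" by (simp add: algebra_simps)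
    also have "\<dots> \<le> real m - \<delta> / 2" using \<eta> \<delta> mult_pos_pos[OF \<eta>(1) \<delta>] by linarith
    finally have "(1 + \<eta>) * (real m - \<delta>) \<le> (1 + \<eta>) * (norm (S w) / a)" using 1 w(2) by linarith
    moreover have "1 + \<eta> > 0" using \<eta>(1) by simp
    ultimately show ?thesis by (rule mult_left_le_imp_le)
  next
    \<comment> \<open>This covers the case that all \<open>z j\<close> vanish, where
      \<open>a = 0\<close>. Then \<open>S w = 0\<close>, hence \<open>w = 0\<close> and
      \<open>real m \<le> \<delta> / 2\<close>, while the quotient by \<open>a\<close> is
      \<open>0\<close>.\<close>
    case False
    then have "a * norm w \<le> 0" by (simp add: mult_nonpos_nonneg)
    with up[OF w(1)] have S0: "norm (S w) = 0" by (metis norm_le_zero_iff norm_zero order_trans)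
    with lo[OF w(1)] w(2) \<delta> show ?thesis by simp
  qed
  have pos: "0 \<le> a" if "j < m" "z j \<noteq> 0" for j
  proof -
    have "0 \<le> a * norm (z j)" using up[OF zA[OF that(1)]] by (rule order_trans[OF norm_ge_zero])
    with that(2) show ?thesis by (simp add: zero_le_mult_iff)
  qed
  have "almost_flat m \<delta> (\<lambda>j. (1 / a) *\<^sub>R S (z j))"
    unfolding almost_flat_def
  proof (intro conjI allI impI)
    fix j assume j: "j < m"
    show "norm ((1 / a) *\<^sub>R S (z j)) \<le> 1"
    proof (cases "z j = 0 \<or> a = 0")
      case True
      then show ?thesis using linear_on_subspace_zero[OF S(1)] by (auto simp: span_zero)
    next
      case False
      with pos[OF j] have "a > 0" by force
      have "norm (z j) \<le> 1" using z j by (simp add: almost_flat_def)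
      with \<open>a > 0\<close> have "a * norm (z j) \<le> a * 1" by (intro mult_left_mono) auto
      with up[OF zA[OF j]] have "norm (S (z j)) \<le> a" by simp
      with \<open>a > 0\<close> show ?thesis by simp
    qed
  next
    fix k assume k: "k \<le> m"
    let ?w = "\<Sum>j<m. (if j < k then 1 else -1) *\<^sub>R z j"
    have "?w \<in> span A" using zA by (intro span_sum span_scale) auto
    moreover have "real m - \<delta> / 2 \<le> norm ?w" using z k by (simp add: almost_flat_def)
    ultimately have "real m - \<delta> \<le> norm (S ?w) / a" by (rule key)
    also have "\<dots> \<le> norm ((1 / a) *\<^sub>R S ?w)" using abs_ge_self[of "norm (S ?w) / a"] by (simp add: abs_divide)
    also have "(1 / a) *\<^sub>R S ?w = (\<Sum>j<m. (if j < k then 1 else -1) *\<^sub>R (1 / a) *\<^sub>R S (z j))"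
      using linear_on_subspace_sum[OF S(1) subspace_span, of "{..<m}" z] zA
      by (simp add: scaleR_sum_right mult.commute)
    finally show "real m - \<delta> \<le> norm (\<Sum>j<m. (if j < k then 1 else -1) *\<^sub>R (1 / a) *\<^sub>R S (z j))" .
  qed
  then show ?thesis by blast
qed

section \<open>Signed sums of an almost flat system\<close>

definition balance :: "nat \<Rightarrow> nat set \<Rightarrow> int" where
  "balance k A = (\<Sum>j\<in>A. if j < k then 1 else -1)"

text \<open>For a sign \<open>\<sigma>\<close> and \<open>\<bar>s\<bar> \<le> 1\<close> the distance
  from \<open>\<sigma>\<close> to \<open>s\<close> is exactly \<open>1 - \<sigma> * s\<close>.
  Replacing the extremal signs by the coefficients \<open>s\<close> therefore costs no more than the
  drop from \<open>m\<close> to the signed sum of the \<open>s j\<close>.\<close>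

lemma almost_flat_signed_sum:
  fixes s :: "nat \<Rightarrow> real"
  assumes x: "almost_flat m \<delta> x" and k: "k \<le> m" and s: "\<And>j. j < m \<Longrightarrow> \<bar>s j\<bar> \<le> 1"
  shows "(\<Sum>j<m. (if j < k then 1 else -1) * s j) - \<delta> \<le> norm (\<Sum>j<m. s j *\<^sub>R x j)"
proof -
  let ?\<sigma> = "\<lambda>j. if j < k then 1 else -1 :: real"
  have "norm (\<Sum>j<m. ?\<sigma> j *\<^sub>R x j) \<le> norm (\<Sum>j<m. s j *\<^sub>R x j) + norm (\<Sum>j<m. (?\<sigma> j - s j) *\<^sub>R x j)"
    by (rule order_trans[OF _ norm_triangle_ineq])
      (simp add: scaleR_diff_left sum_subtractf)
  also have "norm (\<Sum>j<m. (?\<sigma> j - s j) *\<^sub>R x j) \<le> (\<Sum>j<m. 1 - ?\<sigma> j * s j)"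
  proof (rule sum_norm_le)
    fix j assume "j \<in> {..<m}"
    then have "\<bar>s j\<bar> \<le> 1" "norm (x j) \<le> 1" using s x by (auto simp: almost_flat_def)
    moreover from this have "\<bar>?\<sigma> j - s j\<bar> = 1 - ?\<sigma> j * s j" by (auto simp: abs_le_iff)
    ultimately show "norm ((?\<sigma> j - s j) *\<^sub>R x j) \<le> 1 - ?\<sigma> j * s j"
      using mult_left_mono[of "norm (x j)" 1 "\<bar>?\<sigma> j - s j\<bar>"] by simp
  qed
  also have "(\<Sum>j<m. 1 - ?\<sigma> j * s j) = real m - (\<Sum>j<m. ?\<sigma> j * s j)" by (simp add: sum_subtractf)
  finally show ?thesis using x k unfolding almost_flat_def by force
qed

lemma almost_flat_sum_diff:
  assumes x: "almost_flat m \<delta> x" and k: "k \<le> m" and A: "A \<subseteq> {..<m}" and A': "A' \<subseteq> {..<m}"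
  shows "real_of_int \<bar>balance k A - balance k A'\<bar> - \<delta> \<le> norm (sum x A - sum x A')"
proof -
  have bal: "real_of_int (balance k C) = (\<Sum>j<m. (if j < k then 1 else -1) * indicat_real C j)"
    if "C \<subseteq> {..<m}" for C
  proof -
    have "real_of_int (balance k C) = (\<Sum>j\<in>C. if j < k then 1 else -1)"
      by (simp add: balance_def if_distrib cong: if_cong)
    also have "\<dots> = (\<Sum>j<m. (if j < k then 1 else -1) * indicat_real C j)"
      using that by (intro sum.mono_neutral_cong_left) (auto simp: indicator_def)
    finally show ?thesis .
  qed
  have sm: "sum x C = (\<Sum>j<m. indicat_real C j *\<^sub>R x j)" if "C \<subseteq> {..<m}" for C
    using that by (intro sum.mono_neutral_cong_left) (auto simp: indicator_def)
  have 1: "real_of_int (balance k C - balance k D) - \<delta> \<le> norm (sum x C - sum x D)"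
    if "C \<subseteq> {..<m}" "D \<subseteq> {..<m}" for C D
  proof -
    have "(\<Sum>j<m. (if j < k then 1 else -1) * (indicat_real C j - indicat_real D j)) - \<delta>
      \<le> norm (\<Sum>j<m. (indicat_real C j - indicat_real D j) *\<^sub>R x j)"
      by (rule almost_flat_signed_sum[OF x k]) (auto simp: indicator_def)
    then show ?thesis
      by (simp add: bal[OF that(1)] bal[OF that(2)] sm[OF that(1)] sm[OF that(2)]
          right_diff_distrib scaleR_diff_left sum_subtractf)
  qed
  show ?thesis using 1[OF A A'] 1[OF A' A] by (simp add: abs_if norm_minus_commute)
qed

section \<open>Index sets on the Laakso graphs\<close>

lemma laakso_dist_le:
  "(a, b) \<in> (laakso_edges n \<union> (laakso_edges n)\<inverse>) ^^ k \<Longrightarrow> laakso_dist n a b \<le> k"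
  unfolding laakso_dist_def by (rule Least_le)

lemma laakso_dist_walk:
  assumes "a \<in> laakso_vertices n" "b \<in> laakso_vertices n"
  shows "(a, b) \<in> (laakso_edges n \<union> (laakso_edges n)\<inverse>) ^^ laakso_dist n a b"
proof -
  obtain k where "(a, b) \<in> (laakso_edges n \<union> (laakso_edges n)\<inverse>) ^^ k"
    using laakso_connected[OF assms] by (auto simp: rtrancl_power)
  then show ?thesis unfolding laakso_dist_def by (rule LeastI)
qed

lemma laakso_dist_refl [simp]: "laakso_dist n a a = 0"
proof -
  have "laakso_dist n a a \<le> 0" by (rule laakso_dist_le) simp
  then show ?thesis by simp
qed

lemma laakso_dist_triangle:
  assumes "a \<in> laakso_vertices n" "b \<in> laakso_vertices n" "c \<in> laakso_vertices n"
  shows "laakso_dist n a c \<le> laakso_dist n a b + laakso_dist n b c"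
  using laakso_dist_walk[OF assms(1,2)] laakso_dist_walk[OF assms(2,3)]
  by (intro laakso_dist_le) (auto simp: relpow_add)

lemma laakso_dist_commute: "laakso_dist n a b = laakso_dist n b a"
proof -
  let ?R = "laakso_edges n \<union> (laakso_edges n)\<inverse>"
  have "(y, x) \<in> ?R ^^ k" if "(x, y) \<in> ?R ^^ k" for x y k
    using that
  proof (induction k arbitrary: y)
    case (Suc k)
    then obtain w where "(x, w) \<in> ?R ^^ k" "(w, y) \<in> ?R" by auto
    with Suc.IH have "(w, x) \<in> ?R ^^ k" "(y, w) \<in> ?R" by auto
    then show ?case by (metis relpow_Suc_I2)
  qed simp
  then have "(a, b) \<in> ?R ^^ k \<longleftrightarrow> (b, a) \<in> ?R ^^ k" for k by blast
  then show ?thesis by (simp add: laakso_dist_def)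
qed

text \<open>The definition refines the edges of level \<open>n\<close> by copies of level \<open>1\<close>; inductions on distances need
  the opposite view, level \<open>1\<close> with its edges \<open>uv\<close> replaced by the copies \<open>graft u v\<close> of level \<open>n\<close>.\<close>

primrec graft :: "laakso_vertex \<Rightarrow> laakso_vertex \<Rightarrow> laakso_vertex \<Rightarrow> laakso_vertex" where
  "graft u v Source = u"
| "graft u v Sink = v"
| "graft u v (Inner x y p) = Inner (graft u v x) (graft u v y) p"

lemma laakso_copy_graft:
  "laakso_copy (graft u v x) (graft u v y) = map_prod (graft u v) (graft u v) ` laakso_copy x y"
  by (simp add: laakso_copy_def)

text \<open>Grafting commutes with refining a single edge, so the outermost refinement can be
  carried out inside each of the six copies.\<close>

lemma laakso_edges_Suc_graft:
  "laakso_edges (Suc n) =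
     (\<Union>(u, v)\<in>laakso_copy Source Sink. map_prod (graft u v) (graft u v) ` laakso_edges n)"
proof (induction n)
  case 0
  show ?case by auto
next
  case (Suc n)
  have "laakso_edges (Suc (Suc n)) = (\<Union>(x, y)\<in>laakso_edges (Suc n). laakso_copy x y)"
    by (rule laakso_edges.simps)
  also have "\<dots> = (\<Union>(u, v)\<in>laakso_copy Source Sink. \<Union>(x, y)\<in>laakso_edges n.
      laakso_copy (graft u v x) (graft u v y))"
    unfolding Suc.IH by fastforce
  also have "\<dots> = (\<Union>(u, v)\<in>laakso_copy Source Sink.
      map_prod (graft u v) (graft u v) ` laakso_edges (Suc n))"
    by (fastforce simp: laakso_copy_graft image_UN)
  finally show ?case .
qed

lemma Field_map_prod_image: "Field (map_prod f f ` E) = f ` Field E"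
  by (force simp: Field_def)

lemma laakso_vertices_Suc_graft:
  "laakso_vertices (Suc n) = (\<Union>(u, v)\<in>laakso_copy Source Sink. graft u v ` laakso_vertices n)"
  unfolding laakso_vertices_def laakso_edges_Suc_graft
  by (subst Field_Union[symmetric] | simp add: Field_map_prod_image case_prod_beta)+

lemma Source_in_laakso_vertices [simp]: "Source \<in> laakso_vertices n"
  and Sink_in_laakso_vertices [simp]: "Sink \<in> laakso_vertices n"
proof (induction n)
  case 0
  {
    case 1
    show ?case by (simp add: laakso_vertices_def Field_def)
  next
    case 2
    show ?case by (simp add: laakso_vertices_def Field_def)
  }
next
  case (Suc n)
  {
    case 1
    have "graft Source (Inner Source Sink laakso_position.T) Source \<in> laakso_vertices (Suc n)"
      unfolding laakso_vertices_Suc_graft using Suc by (force simp: laakso_copy_def)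
    then show ?case by simp
  next
    case 2
    have "graft (Inner Source Sink laakso_position.B) Sink Sink \<in> laakso_vertices (Suc n)"
      unfolding laakso_vertices_Suc_graft using Suc by (force simp: laakso_copy_def)
    then show ?case by simp
  }
qed

lemma graft_in_laakso_vertices:
  "(u, v) \<in> laakso_copy Source Sink \<Longrightarrow> a \<in> laakso_vertices n \<Longrightarrow> graft u v a \<in> laakso_vertices (Suc n)"
  unfolding laakso_vertices_Suc_graft by blast

lemma laakso_dist_graft:
  assumes uv: "(u, v) \<in> laakso_copy Source Sink"
    and ab: "a \<in> laakso_vertices n" "b \<in> laakso_vertices n"
  shows "laakso_dist (Suc n) (graft u v a) (graft u v b) \<le> laakso_dist n a b"
proof (rule laakso_dist_le)
  let ?R = "\<lambda>n. laakso_edges n \<union> (laakso_edges n)\<inverse>"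
  have step: "(graft u v x, graft u v y) \<in> ?R (Suc n)" if "(x, y) \<in> ?R n" for x y
    unfolding laakso_edges_Suc_graft using that uv by force
  have "(graft u v x, graft u v y) \<in> ?R (Suc n) ^^ k" if "(x, y) \<in> ?R n ^^ k" for x y k
    using that
  proof (induction k arbitrary: y)
    case (Suc k)
    then obtain w where "(x, w) \<in> ?R n ^^ k" "(w, y) \<in> ?R n" by auto
    with Suc.IH step show ?case by (metis relpow_Suc_I)
  qed simp
  from this[OF laakso_dist_walk[OF ab]]
  show "(graft u v a, graft u v b) \<in> ?R (Suc n) ^^ laakso_dist n a b" .
qed

section \<open>Index sets of the vertices and their balances\<close>

fun admissible :: "laakso_position \<Rightarrow> nat set" where
  "admissible laakso_position.T = {0}"
| "admissible laakso_position.L = {0, 1}"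
| "admissible laakso_position.R = {0, 2}"
| "admissible laakso_position.B = {0, 1, 2}"

text \<open>An edge \<open>uv\<close> of level \<open>k\<close> owns a block of \<open>4 ^ (n - k)\<close> indices, namely
  \<open>laakso_set n v - laakso_set n u\<close>. A vertex created on this edge takes a union of quarters of the
  block, which are told apart by the base-\<open>4\<close> digit of weight \<open>4 ^ (n - Suc k)\<close>.\<close>

primrec laakso_set :: "nat \<Rightarrow> laakso_vertex \<Rightarrow> nat set" where
  "laakso_set n Source = {}"
| "laakso_set n Sink = {..<4 ^ n}"
| "laakso_set n (Inner u v p) = laakso_set n u \<union>
     {x \<in> laakso_set n v. x div 4 ^ (n - Suc (max (laakso_depth u) (laakso_depth v))) mod 4 \<in> admissible p}"

lemma laakso_set_subset: "laakso_set n a \<subseteq> {..<4 ^ n}"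
  by (induction a) auto

lemma finite_laakso_set: "finite (laakso_set n a)"
  by (rule finite_subset[OF laakso_set_subset]) simp

lemma laakso_vertices_Suc:
  "laakso_vertices (Suc k) \<subseteq> laakso_vertices k \<union> {Inner u v p |u v p. (u, v) \<in> laakso_edges k}"
  by (force simp: laakso_vertices_def Field_def laakso_copy_def)

text \<open>Grafting raises the depth of an edge by one, and so does the passage from
  \<open>n\<close> to \<open>Suc n\<close>; both sides therefore test a digit of the same weight.
  The block of the copy is the translate by \<open>j * 4 ^ n\<close>.\<close>

lemma laakso_set_graft:
  assumes uv: "(u, v) \<in> laakso_copy Source Sink"
    and v: "laakso_set (Suc n) v = laakso_set (Suc n) u \<union> {j * 4 ^ n..<Suc j * 4 ^ n}"
    and dj: "laakso_set (Suc n) u \<inter> {j * 4 ^ n..<Suc j * 4 ^ n} = {}"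
    and a: "a \<in> laakso_vertices n"
  shows "laakso_set (Suc n) (graft u v a) = laakso_set (Suc n) u \<union> (+) (j * 4 ^ n) ` laakso_set n a"
proof -
  have "x \<in> laakso_set (Suc n) (graft u v a) \<longleftrightarrow>
      x \<in> laakso_set (Suc n) u \<or> j * 4 ^ n \<le> x \<and> x - j * 4 ^ n \<in> laakso_set n a"
    if "a \<in> laakso_vertices k" "k \<le> n" for k x
    using that
  proof (induction k arbitrary: a)
    case 0
    then have "a = Source \<or> a = Sink" by (auto simp: laakso_vertices_def Field_def)
    then show ?case by (auto simp: v)
  next
    case (Suc k)
    show ?case
    proof (cases "a \<in> laakso_vertices k")
      case True
      then show ?thesis using Suc by simp
    next
      case False
      then obtain y z p where a: "a = Inner y z p" and yz: "(y, z) \<in> laakso_edges k"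
        using laakso_vertices_Suc[of k] Suc.prems(1) by blast
      define e where "e = n - Suc k"
      have yzV: "y \<in> laakso_vertices k" "z \<in> laakso_vertices k"
        using yz by (auto simp: laakso_vertices_def Field_def)
      have d1: "max (laakso_depth y) (laakso_depth z) = k" by (rule laakso_edge_depth[OF yz])
      have "(graft u v y, graft u v z) \<in> laakso_edges (Suc k)"
        unfolding laakso_edges_Suc_graft using yz uv by force
      then have d2: "max (laakso_depth (graft u v y)) (laakso_depth (graft u v z)) = Suc k"
        by (rule laakso_edge_depth)
      \<comment> \<open>The translation is by a multiple of \<open>4 * 4 ^ e\<close> and leaves the
        digit of weight \<open>4 ^ e\<close> unchanged.\<close>
      have digit: "x div 4 ^ e mod 4 = (x - j * 4 ^ n) div 4 ^ e mod 4" if "j * 4 ^ n \<le> x"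
      proof -
        have "(4::nat) ^ n = 4 ^ k * 4 * 4 ^ e"
          using Suc.prems(2) by (simp add: e_def flip: power_Suc power_Suc2 power_add)
        then have "x = (x - j * 4 ^ n) + (j * 4 ^ k * 4) * 4 ^ e" using that by simp
        then have "x div 4 ^ e = ((x - j * 4 ^ n) + (j * 4 ^ k * 4) * 4 ^ e) div 4 ^ e" by simp
        also have "\<dots> = (x - j * 4 ^ n) div 4 ^ e + j * 4 ^ k * 4" by simp
        finally show ?thesis by simp
      qed
      show ?thesis
        using Suc.IH[OF yzV(1)] Suc.IH[OF yzV(2)] Suc.prems(2) digit
        by (auto simp: a d1 d2 simp flip: e_def)
    qed
  qed
  from this[OF a] have "x \<in> laakso_set (Suc n) (graft u v a) \<longleftrightarrow>
      x \<in> laakso_set (Suc n) u \<or> j * 4 ^ n \<le> x \<and> x - j * 4 ^ n \<in> laakso_set n a" for x by simp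
  then show ?thesis by (force simp: image_iff)
qed

lemma balance_Un_disjoint:
  "finite A \<Longrightarrow> finite A' \<Longrightarrow> A \<inter> A' = {} \<Longrightarrow> balance k (A \<union> A') = balance k A + balance k A'"
  by (simp add: balance_def sum.union_disjoint)

lemma balance_below: "A \<subseteq> {..<k} \<Longrightarrow> balance k A = int (card A)"
  unfolding balance_def by (subst sum.cong[of A A _ "\<lambda>_. 1"]) auto

lemma balance_above: "A \<inter> {..<k} = {} \<Longrightarrow> balance k A = - int (card A)"
  unfolding balance_def by (subst sum.cong[of A A _ "\<lambda>_. -1"]) auto

lemma balance_shift: "balance (c + k) ((+) c ` A) = balance k A"
  by (simp add: balance_def sum.reindex)

lemma balance_laakso_set_graft:
  assumes uv: "(u, v) \<in> laakso_copy Source Sink"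
    and v: "laakso_set (Suc n) v = laakso_set (Suc n) u \<union> {j * 4 ^ n..<Suc j * 4 ^ n}"
    and dj: "laakso_set (Suc n) u \<inter> {j * 4 ^ n..<Suc j * 4 ^ n} = {}"
    and a: "a \<in> laakso_vertices n"
  shows "balance k (laakso_set (Suc n) (graft u v a)) =
    balance k (laakso_set (Suc n) u) + balance k ((+) (j * 4 ^ n) ` laakso_set n a)"
proof -
  have "(+) (j * 4 ^ n) ` laakso_set n a \<subseteq> {j * 4 ^ n..<Suc j * 4 ^ n}"
    using laakso_set_subset[of n a] by auto
  with dj have "laakso_set (Suc n) u \<inter> (+) (j * 4 ^ n) ` laakso_set n a = {}" by blast
  then show ?thesis
    unfolding laakso_set_graft[OF assms] by (intro balance_Un_disjoint) (auto simp: finite_laakso_set)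
qed

abbreviation "vT \<equiv> Inner Source Sink laakso_position.T"
abbreviation "vL \<equiv> Inner Source Sink laakso_position.L"
abbreviation "vR \<equiv> Inner Source Sink laakso_position.R"
abbreviation "vB \<equiv> Inner Source Sink laakso_position.B"

lemma laakso_set_level_one:
  fixes n :: nat
  defines "M \<equiv> 4 ^ n"
  shows "laakso_set (Suc n) vT = {0..<M}"
    and "laakso_set (Suc n) vL = {0..<2 * M}"
    and "laakso_set (Suc n) vR = {0..<M} \<union> {2 * M..<3 * M}"
    and "laakso_set (Suc n) vB = {0..<3 * M}"
proof -
  have M: "M > 0" by (simp add: M_def)
  have mem: "x \<in> laakso_set (Suc n) (Inner Source Sink p) \<longleftrightarrow> x div M \<in> admissible p" for x p
  proof -
    have "x \<in> laakso_set (Suc n) (Inner Source Sink p) \<longleftrightarrow> x div M < 4 \<and> x div M \<in> admissible p"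
      using M by (auto simp: div_less_iff_less_mult simp flip: M_def)
    moreover have "admissible p \<subseteq> {..<4}" by (cases p) auto
    ultimately show ?thesis by blast
  qed
  have eq: "x div M = i \<longleftrightarrow> i * M \<le> x \<and> x < Suc i * M" for x i
  proof -
    have "x div M = i \<longleftrightarrow> i \<le> x div M \<and> x div M < Suc i" by auto
    with M show ?thesis by (simp only: div_less_iff_less_mult less_eq_div_iff_mult_less_eq)
  qed
  show "laakso_set (Suc n) vT = {0..<M}" "laakso_set (Suc n) vL = {0..<2 * M}"
    "laakso_set (Suc n) vR = {0..<M} \<union> {2 * M..<3 * M}" "laakso_set (Suc n) vB = {0..<3 * M}"
    unfolding set_eq_iff mem by (auto simp: eq)
qed

text \<open>The last two components are the balances at \<open>0\<close> and at the midpoint \<open>2 * M\<close> of the index set of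
  a vertex in the copy grafted on the edge, \<open>M\<close> being the length of the copy and \<open>h\<close> the distance of the
  vertex from the beginning of the edge.\<close>

definition edge_table :: "int \<Rightarrow> int \<Rightarrow> (laakso_vertex \<times> laakso_vertex \<times> int \<times> int) set" where
  "edge_table M h =
     {(Source, vT, - h, h),
      (vT, vL, - (M + h), M + h), (vT, vR, - (M + h), M - h),
      (vL, vB, - (2 * M + h), 2 * M - h), (vR, vB, - (2 * M + h), h),
      (vB, Sink, - (3 * M + h), M - h)}"

text \<open>The last conclusion prepares the table for vertices inside the copy: \<open>h\<close>
  indices of block \<open>j\<close> contribute \<open>- h\<close> to the balance at
  \<open>0\<close>, and at the midpoint \<open>h\<close> or \<open>- h\<close> according to the half
  that contains the block.\<close>

lemma laakso_set_level_one_edge: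
  assumes "(u, v) \<in> laakso_copy Source Sink"
  obtains j where "j < 4" "laakso_set (Suc n) v = laakso_set (Suc n) u \<union> {j * 4 ^ n..<Suc j * 4 ^ n}"
    "laakso_set (Suc n) u \<inter> {j * 4 ^ n..<Suc j * 4 ^ n} = {}"
    "\<And>h. (u, v, balance 0 (laakso_set (Suc n) u) - h,
       balance (2 * 4 ^ n) (laakso_set (Suc n) u) + (if j < 2 then h else - h)) \<in> edge_table (4 ^ n) h"
proof -
  define M :: nat where "M = 4 ^ n"
  have M: "M > 0" "int M = 4 ^ n" by (simp_all add: M_def)
  note c = laakso_set_level_one[of n, folded M_def]
  have sink: "laakso_set (Suc n) Sink = {0..<4 * M}" by (auto simp: M_def)
  have lo: "balance k {x..<y} = int (y - x)" if "y \<le> k" for k x y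
    using that by (subst balance_below) auto
  have hi: "balance k {x..<y} = - int (y - x)" if "k \<le> x" for k x y
    using that by (subst balance_above) auto
  have b3: "balance (2 * M) {0..<3 * M} = int M"
  proof -
    have "{0..<3 * M} = {0..<2 * M} \<union> {2 * M..<3 * M}" by auto
    then have "balance (2 * M) {0..<3 * M} = balance (2 * M) {0..<2 * M} + balance (2 * M) {2 * M..<3 * M}"
      by (simp only:) (rule balance_Un_disjoint, auto)
    then show ?thesis by (simp add: lo hi)
  qed
  have br: "balance k ({0..<M} \<union> {2 * M..<3 * M}) = balance k {0..<M} + balance k {2 * M..<3 * M}" for k
    using M by (intro balance_Un_disjoint) auto
  have e: "balance k {} = 0" for k by (simp add: balance_def)
  consider "u = Source" "v = vT" | "u = vT" "v = vL" | "u = vT" "v = vR"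
    | "u = vL" "v = vB" | "u = vR" "v = vB" | "u = vB" "v = Sink"
    using assms by (auto simp: laakso_copy_def)
  then show thesis
  proof cases
    case 1
    then show ?thesis
      by (intro that[of 0]; simp add: c e edge_table_def del: laakso_set.simps(3) flip: M_def)
  next
    case 2
    then show ?thesis
      by (intro that[of 1]; auto simp add: c lo hi M(2) edge_table_def simp del: laakso_set.simps(3) simp flip: M_def)
  next
    case 3
    then show ?thesis
      by (intro that[of 2]; auto simp add: c lo hi M(2) edge_table_def simp del: laakso_set.simps(3) simp flip: M_def)
  next
    case 4
    then show ?thesis
      by (intro that[of 2]; auto simp add: c lo hi M(2) edge_table_def simp del: laakso_set.simps(3) simp flip: M_def)
  next
    case 5
    then show ?thesis
      by (intro that[of 1]; auto simp add: c lo hi br M(2) edge_table_def simp del: laakso_set.simps(3) simp flip: M_def)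
  next
    case 6
    then show ?thesis
      by (intro that[of 3]; auto simp add: c sink hi b3 M(2) edge_table_def simp del: laakso_set.simps simp flip: M_def)
  qed
qed

lemma balance_graft_table:
  assumes uv: "(u, v) \<in> laakso_copy Source Sink" and a: "a \<in> laakso_vertices n"
  shows "(u, v, balance 0 (laakso_set (Suc n) (graft u v a)), balance (2 * 4 ^ n) (laakso_set (Suc n) (graft u v a)))
    \<in> edge_table (4 ^ n) (int (card (laakso_set n a)))"
proof -
  obtain j where j: "j < 4" "laakso_set (Suc n) v = laakso_set (Suc n) u \<union> {j * 4 ^ n..<Suc j * 4 ^ n}"
    "laakso_set (Suc n) u \<inter> {j * 4 ^ n..<Suc j * 4 ^ n} = {}"
    and tab: "\<And>h. (u, v, balance 0 (laakso_set (Suc n) u) - h,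
       balance (2 * 4 ^ n) (laakso_set (Suc n) u) + (if j < 2 then h else - h)) \<in> edge_table (4 ^ n) h"
    using laakso_set_level_one_edge[OF uv] by blast
  define A where "A = (+) (j * 4 ^ n) ` laakso_set n a"
  have card: "card A = card (laakso_set n a)" unfolding A_def by (rule card_image) simp
  have b0: "balance 0 A = - int (card (laakso_set n a))"
    by (subst balance_above) (auto simp: card)
  have b2: "balance (2 * 4 ^ n) A = (if j < 2 then int (card (laakso_set n a)) else - int (card (laakso_set n a)))"
  proof (cases "j < 2")
    case True
    then have "Suc j * 4 ^ n \<le> (2::nat) * 4 ^ n" by (intro mult_right_mono) auto
    moreover have "A \<subseteq> {..<Suc j * 4 ^ n}" using laakso_set_subset[of n a] by (auto simp: A_def)
    ultimately have "A \<subseteq> {..<2 * 4 ^ n}" by (meson lessThan_subset_iff subset_trans)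
    with True show ?thesis by (simp add: balance_below card)
  next
    case False
    then have "2 * 4 ^ n \<le> j * 4 ^ n + y" for y by (intro trans_le_add1 mult_right_mono) auto
    from leD[OF this] have "A \<inter> {..<2 * 4 ^ n} = {}" by (auto simp: A_def)
    with False show ?thesis by (simp add: balance_above card)
  qed
  show ?thesis
    unfolding balance_laakso_set_graft[OF uv j(2,3) a] A_def[symmetric] b0 b2
    using tab[of "int (card (laakso_set n a))"] by simp
qed

section \<open>Distances compared with balances\<close>

fun vertex_level :: "laakso_vertex \<Rightarrow> int" where
  "vertex_level Source = 0"
| "vertex_level Sink = 4"
| "vertex_level (Inner u v laakso_position.T) = 1"
| "vertex_level (Inner u v laakso_position.L) = 2"
| "vertex_level (Inner u v laakso_position.R) = 2"
| "vertex_level (Inner u v laakso_position.B) = 3"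

text \<open>The graph metric of level one in closed form: \<open>vL\<close> and \<open>vR\<close>
  are the only two vertices on the same level, and any other two lie on a common geodesic from
  \<open>Source\<close> to \<open>Sink\<close>.\<close>

definition level_one_dist :: "laakso_vertex \<Rightarrow> laakso_vertex \<Rightarrow> int" where
  "level_one_dist u v = (if u = v then 0 else if vertex_level u = vertex_level v then 2
     else \<bar>vertex_level u - vertex_level v\<bar>)"

text \<open>Each edge of level one carries a grafted copy of level \<open>n\<close>, whose ends are
  at most \<open>4 ^ n\<close> apart; the rest is the triangle inequality along such edges.\<close>

lemma laakso_dist_level_one:
  assumes M: "int (laakso_dist n Source Sink) \<le> 4 ^ n"
    and u: "u \<in> Field (laakso_copy Source Sink)" and v: "v \<in> Field (laakso_copy Source Sink)"
  shows "int (laakso_dist (Suc n) u v) \<le> level_one_dist u v * 4 ^ n"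
proof -
  define d where "d x y = int (laakso_dist (Suc n) x y)" for x y
  define M :: int where "M = 4 ^ n"
  let ?V = "{Source, vT, vL, vR, vB, Sink}"
  have edge: "d x y \<le> M" if "(x, y) \<in> laakso_copy Source Sink" for x y
    using laakso_dist_graft[OF that, of Source n Sink] M by (simp add: d_def M_def)
  have mem: "x \<in> laakso_vertices (Suc n) \<and> y \<in> laakso_vertices (Suc n)"
    if "(x, y) \<in> laakso_copy Source Sink" for x y
    using graft_in_laakso_vertices[OF that, of Source n] graft_in_laakso_vertices[OF that, of Sink n] by simp
  have V: "?V \<subseteq> laakso_vertices (Suc n)"
    using mem[of vT vL] mem[of vR vB] by (simp add: laakso_copy_def)
  have tri: "d x z \<le> d x y + d y z" if "x \<in> ?V" "y \<in> ?V" "z \<in> ?V" for x y z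
    using laakso_dist_triangle[OF subsetD[OF V that(1)] subsetD[OF V that(2)] subsetD[OF V that(3)]]
    unfolding d_def by linarith
  have sym: "d x y = d y x" for x y unfolding d_def by (simp add: laakso_dist_commute)
  have e: "d Source vT \<le> M" "d vT vL \<le> M" "d vT vR \<le> M" "d vL vB \<le> M" "d vR vB \<le> M" "d vB Sink \<le> M"
    by (rule edge, simp add: laakso_copy_def)+
  have e2: "d Source vL \<le> 2 * M" "d Source vR \<le> 2 * M" "d vT vB \<le> 2 * M"
      "d vL Sink \<le> 2 * M" "d vR Sink \<le> 2 * M" "d vL vR \<le> 2 * M"
    using tri[of Source vT vL] tri[of Source vT vR] tri[of vT vL vB] tri[of vL vB Sink]
      tri[of vR vB Sink] tri[of vL vT vR] e sym[of vL vT] by auto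
  have e3: "d Source vB \<le> 3 * M" "d vT Sink \<le> 3 * M" "d Source Sink \<le> 4 * M"
    using tri[of Source vT vB] tri[of vT vB Sink] tri[of Source vT Sink] e e2 by auto
  have e4: "d vT Source \<le> M" "d vL vT \<le> M" "d vR vT \<le> M" "d vB vL \<le> M" "d vB vR \<le> M"
      "d Sink vB \<le> M" "d vL Source \<le> 2 * M" "d vR Source \<le> 2 * M" "d vB vT \<le> 2 * M"
      "d Sink vL \<le> 2 * M" "d Sink vR \<le> 2 * M" "d vR vL \<le> 2 * M"
      "d vB Source \<le> 3 * M" "d Sink vT \<le> 3 * M" "d Sink Source \<le> 4 * M"
    using e e2 e3 by (simp_all only: sym[of vT Source] sym[of vL Source] sym[of vR Source]
      sym[of vB Source] sym[of Sink Source] sym[of vL vT] sym[of vR vT] sym[of vB vT] sym[of Sink vT]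
      sym[of vR vL] sym[of vB vL] sym[of Sink vL] sym[of vB vR] sym[of Sink vR] sym[of Sink vB])
  have "d x x = 0" for x by (simp add: d_def)
  note bounds = e e2 e3 e4 this
  have "u \<in> ?V" "v \<in> ?V" using u v by (auto simp: laakso_copy_def Field_def)
  then have "d u v \<le> level_one_dist u v * M"
    by (elim insertE emptyE; simp only: level_one_dist_def; simp add: bounds)
  then show ?thesis by (simp add: d_def M_def)
qed

lemma card_laakso_set_le: "int (card (laakso_set n a)) \<le> 4 ^ n"
proof -
  have "card (laakso_set n a) \<le> card {..<4 ^ n :: nat}" by (rule card_mono[OF _ laakso_set_subset]) simp
  then have "card (laakso_set n a) \<le> 4 ^ n" by simp
  then show ?thesis by (metis of_nat_le_iff of_nat_numeral of_nat_power)
qed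

text \<open>A walk can enter the copy at \<open>u\<close> and go the distance \<open>h\<close>, or
  enter at \<open>v\<close> and go the remaining \<open>4 ^ n - h\<close>.\<close>

lemma laakso_dist_graft_ends:
  assumes uv: "(u, v) \<in> laakso_copy Source Sink" and a: "a \<in> laakso_vertices n"
    and ends: "int (laakso_dist n Source a) \<le> h" "int (laakso_dist n a Sink) \<le> 4 ^ n - h"
    and w: "w \<in> Field (laakso_copy Source Sink)" and M: "int (laakso_dist n Source Sink) \<le> 4 ^ n"
  shows "int (laakso_dist (Suc n) w (graft u v a)) \<le> level_one_dist w u * 4 ^ n + h"
    and "int (laakso_dist (Suc n) w (graft u v a)) \<le> level_one_dist w v * 4 ^ n + (4 ^ n - h)"
proof -
  have F: "u \<in> Field (laakso_copy Source Sink)" "v \<in> Field (laakso_copy Source Sink)"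
    using uv by (auto simp: Field_def)
  have V: "x \<in> laakso_vertices (Suc n)" if "x \<in> Field (laakso_copy Source Sink)" for x
    using that graft_in_laakso_vertices[of _ _ Source n] graft_in_laakso_vertices[of _ _ Sink n]
    by (fastforce simp: Field_def)
  note g = graft_in_laakso_vertices[OF uv a]
  have "int (laakso_dist (Suc n) w (graft u v a)) \<le>
      int (laakso_dist (Suc n) w u) + int (laakso_dist (Suc n) u (graft u v a))"
    using laakso_dist_triangle[OF V[OF w] V[OF F(1)] g] by simp
  moreover have "int (laakso_dist (Suc n) u (graft u v a)) \<le> h"
    using laakso_dist_graft[OF uv, of Source n a] a ends by simp
  ultimately show "int (laakso_dist (Suc n) w (graft u v a)) \<le> level_one_dist w u * 4 ^ n + h"
    using laakso_dist_level_one[OF M w F(1)] by linarith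
  have "int (laakso_dist (Suc n) w (graft u v a)) \<le>
      int (laakso_dist (Suc n) w v) + int (laakso_dist (Suc n) (graft u v a) v)"
    using laakso_dist_triangle[OF V[OF w] V[OF F(2)] g] laakso_dist_commute[of "Suc n" v] by simp
  moreover have "int (laakso_dist (Suc n) (graft u v a) v) \<le> 4 ^ n - h"
    using laakso_dist_graft[OF uv a, of Sink] ends by simp
  ultimately show "int (laakso_dist (Suc n) w (graft u v a)) \<le> level_one_dist w v * 4 ^ n + (4 ^ n - h)"
    using laakso_dist_level_one[OF M w F(2)] by linarith
qed

lemma laakso_vertices_Suc_cases:
  assumes "a \<in> laakso_vertices (Suc n)"
  obtains u v b where "(u, v) \<in> laakso_copy Source Sink" "b \<in> laakso_vertices n" "a = graft u v b"
  using assms unfolding laakso_vertices_Suc_graft by auto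

text \<open>The cardinality of the index set serves as the height of the vertex. Both estimates go
  through the induction together, because at \<open>Sink\<close> the first one bounds the length of
  a whole copy.\<close>

lemma laakso_dist_Source_Sink_le:
  assumes "a \<in> laakso_vertices n"
  shows "int (laakso_dist n Source a) \<le> int (card (laakso_set n a)) \<and>
    int (laakso_dist n a Sink) \<le> 4 ^ n - int (card (laakso_set n a))"
  using assms
proof (induction n arbitrary: a)
  case 0
  have "laakso_dist 0 Source Sink \<le> 1" by (rule laakso_dist_le) simp
  with 0 show ?case by (auto simp: laakso_vertices_def Field_def)
next
  case (Suc n)
  obtain u v b where uv: "(u, v) \<in> laakso_copy Source Sink" and b: "b \<in> laakso_vertices n"
    and a: "a = graft u v b"
    using laakso_vertices_Suc_cases[OF Suc.prems] by blast
  note IH = Suc.IH[OF b]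
  have M: "int (laakso_dist n Source Sink) \<le> 4 ^ n" using Suc.IH[of Sink] by simp
  have F: "Source \<in> Field (laakso_copy Source Sink)" "Sink \<in> Field (laakso_copy Source Sink)"
    by (auto simp: laakso_copy_def Field_def)
  note d = laakso_dist_graft_ends[OF uv b conjunct1[OF IH] conjunct2[OF IH] _ M]
  \<comment> \<open>With the switch at \<open>0\<close> every index counts \<open>-1\<close>, so the
    third entries of \<open>edge_table\<close> are the negatives of the heights.\<close>
  have "balance 0 (laakso_set (Suc n) a) = - int (card (laakso_set (Suc n) a))"
    by (rule balance_above) simp
  with balance_graft_table[OF uv b] d(1)[OF F(1)] d(2)[OF F(2)]
  show ?case
    unfolding a laakso_dist_commute[of _ "graft u v b" Sink]
    by (auto simp: edge_table_def level_one_dist_def)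
qed

text \<open>The factor \<open>2\<close> is lost only for the opposite edges \<open>TL\<close>, \<open>RB\<close> (and \<open>TR\<close>, \<open>LB\<close>): there the two
  balances differ by \<open>M + q - p\<close> and \<open>M + p - q\<close>, one of which is at least \<open>M\<close>, while \<open>D \<le> 2 * M\<close>
  since the cycle has length \<open>4 * M\<close>.\<close>

lemma edge_table_separation:
  fixes D M p q :: int
  assumes "(u, v, s, t) \<in> edge_table M p" "(u', v', s', t') \<in> edge_table M q"
    and "(u, v) \<noteq> (u', v')" and "0 \<le> p" "p \<le> M" "0 \<le> q" "q \<le> M"
    and "D \<le> p + level_one_dist u u' * M + q"
    and "D \<le> p + level_one_dist u v' * M + (M - q)"
    and "D \<le> (M - p) + level_one_dist v u' * M + q"
    and "D \<le> (M - p) + level_one_dist v v' * M + (M - q)"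
  shows "D \<le> 2 * \<bar>s - s'\<bar> \<or> D \<le> 2 * \<bar>t - t'\<bar>"
  using assms unfolding edge_table_def
  by (elim insertE emptyE; simp add: level_one_dist_def abs_if; linarith?)

text \<open>Two vertices in the same copy inherit \<open>k\<close> from the lower level, shifted to
  the block of the copy. In different copies, the four routes through the ends of the two edges
  bound the distance, and \<open>k = 0\<close> or the midpoint works.\<close>

lemma laakso_dist_le_balance:
  assumes "a \<in> laakso_vertices n" "b \<in> laakso_vertices n"
  shows "\<exists>k\<le>4 ^ n. int (laakso_dist n a b) \<le> 2 * \<bar>balance k (laakso_set n a) - balance k (laakso_set n b)\<bar>"
  using assms
proof (induction n arbitrary: a b)
  case 0
  have "laakso_dist 0 Source Sink \<le> 1" by (rule laakso_dist_le) simp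
  with 0 show ?case
    using laakso_dist_commute[of 0 Sink Source]
    by (intro exI[of _ 0]) (auto simp: laakso_vertices_def Field_def balance_def)
next
  case (Suc n)
  obtain u v a' where uv: "(u, v) \<in> laakso_copy Source Sink" and a': "a' \<in> laakso_vertices n"
    and a: "a = graft u v a'"
    using laakso_vertices_Suc_cases[OF Suc.prems(1)] by blast
  obtain u' v' b' where uv': "(u', v') \<in> laakso_copy Source Sink" and b': "b' \<in> laakso_vertices n"
    and b: "b = graft u' v' b'"
    using laakso_vertices_Suc_cases[OF Suc.prems(2)] by blast
  show ?case
  proof (cases "(u, v) = (u', v')")
    case True
    obtain j where j: "j < 4" "laakso_set (Suc n) v = laakso_set (Suc n) u \<union> {j * 4 ^ n..<Suc j * 4 ^ n}"
      "laakso_set (Suc n) u \<inter> {j * 4 ^ n..<Suc j * 4 ^ n} = {}"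
      by (rule laakso_set_level_one_edge[OF uv, where n = n]) (rule that; assumption)
    obtain k where k: "k \<le> 4 ^ n"
      "int (laakso_dist n a' b') \<le> 2 * \<bar>balance k (laakso_set n a') - balance k (laakso_set n b')\<bar>"
      using Suc.IH[OF a' b'] by blast
    have "j * 4 ^ n + k \<le> Suc j * 4 ^ n" using k(1) by simp
    also have "\<dots> \<le> 4 * 4 ^ n" using j(1) by (intro mult_right_mono) auto
    finally have "j * 4 ^ n + k \<le> 4 ^ Suc n" by simp
    moreover have "int (laakso_dist (Suc n) a b) \<le> int (laakso_dist n a' b')"
      using laakso_dist_graft[OF uv a' b'] True by (simp add: a b)
    moreover have "balance (j * 4 ^ n + k) (laakso_set (Suc n) a) - balance (j * 4 ^ n + k) (laakso_set (Suc n) b) =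
        balance k (laakso_set n a') - balance k (laakso_set n b')"
    proof -
      have "a = graft u v a'" "b = graft u v b'" using a b True by auto
      then show ?thesis
        by (simp only: balance_laakso_set_graft[OF uv j(2,3) a'] balance_laakso_set_graft[OF uv j(2,3) b'] balance_shift
            add_diff_cancel_left)
    qed
    ultimately show ?thesis using k(2) by (intro exI[of _ "j * 4 ^ n + k"]) simp
  next
    case False
    define h where "h c = int (card (laakso_set n c))" for c
    have ends: "int (laakso_dist n Source c) \<le> h c" "int (laakso_dist n c Sink) \<le> 4 ^ n - h c"
      if "c \<in> laakso_vertices n" for c
      using laakso_dist_Source_Sink_le[OF that] by (auto simp: h_def)
    have M: "int (laakso_dist n Source Sink) \<le> 4 ^ n"
      using ends(1)[of Sink] card_laakso_set_le[of n Sink] by (simp add: h_def)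
    have F: "u \<in> Field (laakso_copy Source Sink)" "v \<in> Field (laakso_copy Source Sink)"
      using uv by (auto simp: Field_def)
    have V: "u \<in> laakso_vertices (Suc n)" "v \<in> laakso_vertices (Suc n)"
      using graft_in_laakso_vertices[OF uv, of Source n] graft_in_laakso_vertices[OF uv, of Sink n] by auto
    have via: "int (laakso_dist (Suc n) a b) \<le> int (laakso_dist (Suc n) w a) + int (laakso_dist (Suc n) w b)"
      if "w \<in> laakso_vertices (Suc n)" for w
      using laakso_dist_triangle[OF Suc.prems(1) that Suc.prems(2)] laakso_dist_commute[of "Suc n" w a] by simp
    have near: "int (laakso_dist (Suc n) u a) \<le> h a'" "int (laakso_dist (Suc n) v a) \<le> 4 ^ n - h a'"
      using laakso_dist_graft_ends(1)[OF uv a' ends[OF a'] F(1) M]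
        laakso_dist_graft_ends(2)[OF uv a' ends[OF a'] F(2) M]
      by (simp_all add: a level_one_dist_def)
    note far = laakso_dist_graft_ends[OF uv' b' ends[OF b'] _ M, folded b]
    have "int (laakso_dist (Suc n) a b) \<le> 2 * \<bar>balance 0 (laakso_set (Suc n) a) - balance 0 (laakso_set (Suc n) b)\<bar> \<or>
        int (laakso_dist (Suc n) a b) \<le> 2 * \<bar>balance (2 * 4 ^ n) (laakso_set (Suc n) a) - balance (2 * 4 ^ n) (laakso_set (Suc n) b)\<bar>"
    proof (rule edge_table_separation[OF _ _ False])
      show "(u, v, balance 0 (laakso_set (Suc n) a), balance (2 * 4 ^ n) (laakso_set (Suc n) a)) \<in> edge_table (4 ^ n) (h a')"
        unfolding a h_def by (rule balance_graft_table[OF uv a'])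
      show "(u', v', balance 0 (laakso_set (Suc n) b), balance (2 * 4 ^ n) (laakso_set (Suc n) b)) \<in> edge_table (4 ^ n) (h b')"
        unfolding b h_def by (rule balance_graft_table[OF uv' b'])
      show "0 \<le> h a'" "h a' \<le> 4 ^ n" "0 \<le> h b'" "h b' \<le> 4 ^ n"
        using card_laakso_set_le by (auto simp: h_def)
      show "int (laakso_dist (Suc n) a b) \<le> h a' + level_one_dist u u' * 4 ^ n + h b'"
        using via[OF V(1)] near(1) far(1)[OF F(1)] by linarith
      show "int (laakso_dist (Suc n) a b) \<le> h a' + level_one_dist u v' * 4 ^ n + (4 ^ n - h b')"
        using via[OF V(1)] near(1) far(2)[OF F(1)] by linarith
      show "int (laakso_dist (Suc n) a b) \<le> 4 ^ n - h a' + level_one_dist v u' * 4 ^ n + h b'"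
        using via[OF V(2)] near(2) far(1)[OF F(2)] by linarith
      show "int (laakso_dist (Suc n) a b) \<le> 4 ^ n - h a' + level_one_dist v v' * 4 ^ n + (4 ^ n - h b')"
        using via[OF V(2)] near(2) far(2)[OF F(2)] by linarith
    qed
    then show ?thesis
    proof
      assume "int (laakso_dist (Suc n) a b) \<le> 2 * \<bar>balance 0 (laakso_set (Suc n) a) - balance 0 (laakso_set (Suc n) b)\<bar>"
      then show ?thesis by (intro exI[of _ 0] conjI) simp_all
    next
      assume *: "int (laakso_dist (Suc n) a b) \<le> 2 * \<bar>balance (2 * 4 ^ n) (laakso_set (Suc n) a) - balance (2 * 4 ^ n) (laakso_set (Suc n) b)\<bar>"
      show ?thesis by (rule exI[of _ "2 * 4 ^ n"], rule conjI[OF _ *]) simp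
    qed
  qed
qed

text \<open>This gives the Lipschitz bound: the images of adjacent vertices differ by a single
  vector of the unit ball.\<close>

lemma laakso_set_edge:
  assumes "(a, b) \<in> laakso_edges n"
  shows "\<exists>i<4 ^ n. laakso_set n b = insert i (laakso_set n a) \<and> i \<notin> laakso_set n a"
  using assms
proof (induction n arbitrary: a b)
  case 0
  then show ?case by auto
next
  case (Suc n)
  obtain u v x y where uv: "(u, v) \<in> laakso_copy Source Sink" and xy: "(x, y) \<in> laakso_edges n"
    and ab: "a = graft u v x" "b = graft u v y"
    using Suc.prems unfolding laakso_edges_Suc_graft by auto
  obtain j where j: "j < 4" "laakso_set (Suc n) v = laakso_set (Suc n) u \<union> {j * 4 ^ n..<Suc j * 4 ^ n}"
    "laakso_set (Suc n) u \<inter> {j * 4 ^ n..<Suc j * 4 ^ n} = {}"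
    by (rule laakso_set_level_one_edge[OF uv, where n = n]) (rule that; assumption)
  obtain i where i: "i < 4 ^ n" "laakso_set n y = insert i (laakso_set n x)" "i \<notin> laakso_set n x"
    using Suc.IH[OF xy] by blast
  have xyV: "x \<in> laakso_vertices n" "y \<in> laakso_vertices n"
    using xy by (auto simp: laakso_vertices_def Field_def)
  have "j * 4 ^ n + i \<in> {j * 4 ^ n..<Suc j * 4 ^ n}" using i(1) by simp
  with j(3) have "j * 4 ^ n + i \<notin> laakso_set (Suc n) u" by blast
  moreover have "j * 4 ^ n + i < 4 ^ Suc n"
  proof -
    have "j * 4 ^ n + i < Suc j * 4 ^ n" using i(1) by simp
    also have "\<dots> \<le> 4 * 4 ^ n" using j(1) by (intro mult_right_mono) auto
    finally show ?thesis by simp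
  qed
  ultimately show ?case
    using i unfolding ab laakso_set_graft[OF uv j(2,3) xyV(1)] laakso_set_graft[OF uv j(2,3) xyV(2)]
    by (intro exI[of _ "j * 4 ^ n + i"]) auto
qed

lemma lipschitz_of_edges:
  fixes f :: "laakso_vertex \<Rightarrow> 'a::real_normed_vector"
  assumes edge: "\<And>x y. (x, y) \<in> laakso_edges n \<Longrightarrow> norm (f x - f y) \<le> 1"
    and ab: "a \<in> laakso_vertices n" "b \<in> laakso_vertices n"
  shows "norm (f a - f b) \<le> real (laakso_dist n a b)"
proof -
  have "norm (f x - f y) \<le> real k" if "(x, y) \<in> (laakso_edges n \<union> (laakso_edges n)\<inverse>) ^^ k" for x y k
    using that
  proof (induction k arbitrary: y)
    case (Suc k)
    then obtain w where w: "norm (f x - f w) \<le> real k" "(w, y) \<in> laakso_edges n \<union> (laakso_edges n)\<inverse>"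
      by auto
    then have "norm (f w - f y) \<le> 1" using edge[of w y] edge[of y w] by (auto simp: norm_minus_commute)
    with w(1) norm_triangle_ineq[of "f x - f w" "f w - f y"] show ?case by simp
  qed simp
  then show ?thesis using laakso_dist_walk[OF ab] by blast
qed

lemma almost_flat_laakso_embedding:
  assumes x: "almost_flat (4 ^ n) \<epsilon> x"
    and ab: "a \<in> laakso_vertices n" "b \<in> laakso_vertices n"
  defines "f \<equiv> \<lambda>a. sum x (laakso_set n a)"
  shows "1 / 2 * real (laakso_dist n a b) - \<epsilon> \<le> norm (f a - f b)"
    and "norm (f a - f b) \<le> real (laakso_dist n a b)"
proof -
  obtain k where k: "k \<le> 4 ^ n" "int (laakso_dist n a b) \<le> 2 * \<bar>balance k (laakso_set n a) - balance k (laakso_set n b)\<bar>"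
    using laakso_dist_le_balance[OF ab] by blast
  have "real (laakso_dist n a b) \<le> 2 * real_of_int \<bar>balance k (laakso_set n a) - balance k (laakso_set n b)\<bar>"
    using k(2) by linarith
  with almost_flat_sum_diff[OF x k(1) laakso_set_subset laakso_set_subset, of a b]
  show "1 / 2 * real (laakso_dist n a b) - \<epsilon> \<le> norm (f a - f b)" by (simp add: f_def)
  show "norm (f a - f b) \<le> real (laakso_dist n a b)"
  proof (rule lipschitz_of_edges[OF _ ab])
    fix c d assume "(c, d) \<in> laakso_edges n"
    then obtain i where "i < 4 ^ n" "laakso_set n d = insert i (laakso_set n c)" "i \<notin> laakso_set n c" using laakso_set_edge by blast
    then show "norm (f c - f d) \<le> 1"
      using x by (simp add: f_def finite_laakso_set almost_flat_def)
  qed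
qed

theorem theorem6:
  fixes \<epsilon> :: real and n :: nat
  assumes "finitely_representable TYPE('y::banach) TYPE('x::banach)"
    and "\<not> reflexive_space TYPE('y)"
    and "\<epsilon> > 0"
    and "n \<ge> 1"
  shows "\<exists>f :: laakso_vertex \<Rightarrow> 'x.
           \<forall>a\<in>laakso_vertices n. \<forall>b\<in>laakso_vertices n.
             1 / 2 * real (laakso_dist n a b) - \<epsilon> \<le> norm (f a - f b) \<and>
             norm (f a - f b) \<le> real (laakso_dist n a b)"
proof -
  obtain x :: "nat \<Rightarrow> 'y" and g C where "james_triangle x g C"
    using nonreflexive_james_triangle[OF assms(2)] by blast
  \<comment> \<open>The other half of \<open>\<epsilon>\<close> is spent on the passage from
    \<open>'y\<close> to \<open>'x\<close>.\<close>
  then obtain z :: "nat \<Rightarrow> 'y" where "almost_flat (4 ^ n) (\<epsilon> / 2) z"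
    by (rule james_triangle_almost_flat[of x g C "4 ^ n" "\<epsilon> / 2"]) (use assms(3) in auto)
  then obtain w :: "nat \<Rightarrow> 'x" where w: "almost_flat (4 ^ n) \<epsilon> w"
    using almost_flat_finitely_representable[OF assms(1) _ _ assms(3), of "4 ^ n" z] by auto
  show ?thesis
    by (intro exI[of _ "\<lambda>a. sum w (laakso_set n a)"]) (use almost_flat_laakso_embedding[OF w] in auto)
qed

end
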